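(* Let $X$ and $Y$ be separable Hilbert spaces and $\sigma > 0$, and consider observations $y = Au + \sigma w$ of $u \in X$ perturbed by Gaussian white noise $\sigma w$ on $Y$. If the forward mapping is an injective Hilbert--Schmidt operator $A: X \to Y$, then $\Phi(u,y) = \Psi(Au,y)$, with $\Psi$ given by $$\Psi(z,y) = -\ln\frac{\mathrm{d}\nu_{(z,\cdot)_Y}}{\mathrm{d}\nu}(y) = \frac{1}{2\sigma^2}\|z\|_Y^2 - \frac{1}{\sigma^2}\langle y, z\rangle_{Y^*\times Y} \quad \nu\text{-a.e.}, \qquad z \in Y,$$ satisfies, as a function of $u$ for the given data $y$, the following two conditions: (i) $\Phi(\cdot,y)$ is Lipschitz continuous on bounded sets, i.e., for every $r > 0$ there exists $L = L(r) > 0$ such that $|\Phi(u_1,y) - \Phi(u_2,y)| \le L\|u_1 - u_2\|_X$ for all $u_1, u_2 \in B_r(0)$; (ii) there exists $\underline{L} \ge 0$ such that $\Phi(u,y) \ge \Phi(0,y) - \underline{L}\|u\|_X$ for all $u \in X$.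
   Context: $B_r(0)$ is the open ball of radius $r$ around $0$ in $X$. A standard Gaussian white noise process $w$ on $Y$ almost surely takes values in the algebraic dual space $Y^*$ of $Y$; it is characterized by the property that each marginal $\langle w,g\rangle_{Y^*\times Y}$, $g \in Y$, is a centered real Gaussian random variable and $\mathbb{E}[\langle w,g\rangle_{Y^*\times Y}\langle w,h\rangle_{Y^*\times Y}] = (g,h)_Y$ for all $g,h \in Y$. For any self-adjoint, positive, trace class operator $Q$ on $Y$, $w$ almost surely takes values in the topological dual $V'$ of $V := \operatorname{ran}(Q^{1/2}) \subset Y$ (with $\operatorname{ran}$ denoting the range), and is thus interpreted as a $V'$-valued Gaussian random variable. $\nu$ denotes the distribution of $\sigma w$ on $V'$, and $\nu_{(z,\cdot)_Y} = \nu(\cdot - (z,\cdot)_Y)$ is its shift by the functional $(z,\cdot)_Y$, which is absolutely continuous with respect to $\nu$ for every $z \in Y$. $\Phi$ is the negative log-likelihood; the data $y$ is considered as fixed. *)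

theory Defs
  imports "HOL-Probability.Probability"
begin

(* Separable (real) Hilbert spaces are the types of sort {real_inner, polish_space}:
   polish_space is complete_space + second_countable_topology, and for metric spaces second
   countability is separability. *)

section \<open>Operators on Hilbert spaces\<close>

definition orthonormal_basis :: "'a::real_inner set \<Rightarrow> bool" where
  "orthonormal_basis B \<longleftrightarrow>
     (\<forall>e\<in>B. norm e = 1) \<and> pairwise orthogonal B \<and> closure (span B) = UNIV"

definition hilbert_schmidt :: "('a::real_inner \<Rightarrow> 'b::real_inner) \<Rightarrow> bool" where
  "hilbert_schmidt A \<longleftrightarrow> bounded_linear A \<and>
     (\<exists>B. orthonormal_basis B \<and> (\<lambda>e. (norm (A e))\<^sup>2) summable_on B)"

(* "Positive" is strict positivity.  For self-adjoint Q this makes the range of Q^{1/2} dense,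
   which is needed for the law on the dual of this range to determine the shift by (z, _) for
   every z in Y and not only for z in the closure of the range. *)
definition positive_selfadjoint :: "('a::real_inner \<Rightarrow> 'a) \<Rightarrow> bool" where
  "positive_selfadjoint Q \<longleftrightarrow> bounded_linear Q \<and>
     (\<forall>x y. Q x \<bullet> y = x \<bullet> Q y) \<and> (\<forall>x. x \<noteq> 0 \<longrightarrow> 0 < Q x \<bullet> x)"

(* For positive Q the absolute value |Q| in the definition of the trace class is Q itself. *)
definition positive_trace_class :: "('a::real_inner \<Rightarrow> 'a) \<Rightarrow> bool" where
  "positive_trace_class Q \<longleftrightarrow> positive_selfadjoint Q \<and>
     (\<exists>B. orthonormal_basis B \<and> (\<lambda>e. Q e \<bullet> e) summable_on B)"

(* On a Hilbert space the positive square root of a positive operator exists and is unique, so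
   that the choice made here is immaterial. *)
definition op_sqrt :: "('a::real_inner \<Rightarrow> 'a) \<Rightarrow> 'a \<Rightarrow> 'a" where
  "op_sqrt Q = (SOME R. positive_selfadjoint R \<and> R \<circ> R = Q)"

section \<open>The space V = ran(Q^{1/2}) and its topological dual\<close>

definition sqrt_range :: "('a::real_inner \<Rightarrow> 'a) \<Rightarrow> 'a set" where
  "sqrt_range Q = range (op_sqrt Q)"

(* The Hilbert norm |v|_V = |Q^{-1/2} v|_Y; Q^{1/2} is injective because Q is strictly positive. *)
definition sqrt_range_norm :: "('a::real_inner \<Rightarrow> 'a) \<Rightarrow> 'a \<Rightarrow> real" where
  "sqrt_range_norm Q v = norm (inv (op_sqrt Q) v)"

(* V' with respect to the Hilbert norm of V.  Since V is a set, not a type, functionals on V are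
   represented by functions that are undefined outside V. *)
definition sqrt_range_dual :: "('a::real_inner \<Rightarrow> 'a) \<Rightarrow> ('a \<Rightarrow> real) set" where
  "sqrt_range_dual Q = {f \<in> extensional (sqrt_range Q).
     (\<forall>u\<in>sqrt_range Q. \<forall>v\<in>sqrt_range Q. f (u + v) = f u + f v) \<and>
     (\<forall>c. \<forall>v\<in>sqrt_range Q. f (c *\<^sub>R v) = c * f v) \<and>
     (\<exists>C. \<forall>v\<in>sqrt_range Q. \<bar>f v\<bar> \<le> C * sqrt_range_norm Q v)}"

definition sqrt_range_dual_norm :: "('a::real_inner \<Rightarrow> 'a) \<Rightarrow> ('a \<Rightarrow> real) \<Rightarrow> real" where
  "sqrt_range_dual_norm Q f =
     (SUP v\<in>{v \<in> sqrt_range Q. sqrt_range_norm Q v \<le> 1}. \<bar>f v\<bar>)"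

(* V' with the Borel sigma-algebra of its norm topology (the measure itself is irrelevant). *)
definition sqrt_range_dual_borel :: "('a::real_inner \<Rightarrow> 'a) \<Rightarrow> ('a \<Rightarrow> real) measure" where
  "sqrt_range_dual_borel Q = sigma (sqrt_range_dual Q)
     {U. U \<subseteq> sqrt_range_dual Q \<and>
         (\<forall>f\<in>U. \<exists>\<epsilon>>0. \<forall>g\<in>sqrt_range_dual Q.
            sqrt_range_dual_norm Q (\<lambda>v. g v - f v) < \<epsilon> \<longrightarrow> g \<in> U)}"

section \<open>White noise\<close>

(* The point mass at 0 is admitted as a degenerate Gaussian. *)
definition centered_gaussian :: "'w measure \<Rightarrow> ('w \<Rightarrow> real) \<Rightarrow> bool" where
  "centered_gaussian P X \<longleftrightarrow> X \<in> borel_measurable P \<and>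
     ((AE \<omega> in P. X \<omega> = 0) \<or> (\<exists>s>0. distributed P lborel X (normal_density 0 s)))"

(* w takes values in the algebraic dual of Y, the pairing of w \<omega> with g being w \<omega> g.  The last
   clause does not follow from the preceding ones: these determine each w(g) only up to a null
   set depending on g, and redefining w on such null sets can destroy the continuity on the range
   of Q^{1/2}.  It selects the versions for which w is almost surely V'-valued; on a complete
   probability space such a version exists, where the null set may depend on Q. *)
definition white_noise :: "'w measure \<Rightarrow> ('w \<Rightarrow> 'a::real_inner \<Rightarrow> real) \<Rightarrow> bool" where
  "white_noise P w \<longleftrightarrow> prob_space P \<and>
     (AE \<omega> in P. linear (w \<omega>)) \<and>
     (\<forall>g. centered_gaussian P (\<lambda>\<omega>. w \<omega> g)) \<and>
     (\<forall>g h. (\<integral>\<omega>. w \<omega> g * w \<omega> h \<partial>P) = g \<bullet> h) \<and>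
     (\<forall>Q. positive_trace_class Q \<longrightarrow>
        (AE \<omega> in P. restrict (w \<omega>) (sqrt_range Q) \<in> sqrt_range_dual Q))"

(* The law \<nu> of \<sigma>w on V'.  The event that w is V'-valued has full measure but need not be
   measurable, hence the completion; off this event the value 0 is used. *)
definition noise_law ::
    "'w measure \<Rightarrow> ('w \<Rightarrow> 'a::real_inner \<Rightarrow> real) \<Rightarrow> real \<Rightarrow> ('a \<Rightarrow> 'a) \<Rightarrow> ('a \<Rightarrow> real) measure" where
  "noise_law P w \<sigma> Q = distr (completion P) (sqrt_range_dual_borel Q)
     (\<lambda>\<omega>. let f = restrict (\<lambda>v. \<sigma> * w \<omega> v) (sqrt_range Q)
          in if f \<in> sqrt_range_dual Q then f else restrict (\<lambda>v. 0) (sqrt_range Q))"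

(* \<nu>(_ - (z, _)) is the image of \<nu> under the translation of V' by the functional (z, _). *)
definition shifted_noise_law ::
    "'w measure \<Rightarrow> ('w \<Rightarrow> 'a::real_inner \<Rightarrow> real) \<Rightarrow> real \<Rightarrow> ('a \<Rightarrow> 'a) \<Rightarrow> 'a \<Rightarrow> ('a \<Rightarrow> real) measure" where
  "shifted_noise_law P w \<sigma> Q z = distr (noise_law P w \<sigma> Q) (sqrt_range_dual_borel Q)
     (\<lambda>f. restrict (\<lambda>v. f v + z \<bullet> v) (sqrt_range Q))"

section \<open>The negative log-likelihood\<close>

(* y is a functional on Y, an element of the algebraic dual.  The explicit formula fixes a
   version, for every y, of the almost everywhere defined logarithmic density. *)
definition Psi :: "real \<Rightarrow> 'b::real_inner \<Rightarrow> ('b \<Rightarrow> real) \<Rightarrow> real" where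
  "Psi \<sigma> z y = 1 / (2 * \<sigma>\<^sup>2) * (norm z)\<^sup>2 - 1 / \<sigma>\<^sup>2 * y z"

definition Phi :: "('a \<Rightarrow> 'b::real_inner) \<Rightarrow> real \<Rightarrow> 'a \<Rightarrow> ('b \<Rightarrow> real) \<Rightarrow> real" where
  "Phi A \<sigma> u y = Psi \<sigma> (A u) y"

end

theory Submission
  imports Defs
begin

text \<open>Both laws on \<open>V'\<close> are identified through their characteristic functionals: under the density
  \<open>exp (w(b) - |b|^2 / 2)\<close> the variable \<open>w(g)\<close> becomes normal with mean \<open>(b, g)\<close> and variance \<open>|g|^2\<close>,
  which for \<open>b = z / \<sigma>\<close> and \<open>g = \<sigma> v\<close> is the law of the shifted noise; and a finite measure on
  \<open>V'\<close> is determined by its characteristic functional, because \<open>V'\<close> is separable and its Borel sets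
  are therefore generated by the evaluations at points of \<open>V\<close>.

  For the bounds on \<open>\<Phi>\<close>, the operator \<open>K = A A\<^sup>* + Q\<close> is again strictly positive and of trace class, so that
  \<open>w\<close> is almost surely bounded on the range of \<open>K\<^sup>1\<^sup>/\<^sup>2\<close>, and \<open>A\<close> maps \<open>X\<close> contractively into this range
  since \<open>A A\<^sup>* \<le> K\<close>. Hence \<open>u \<mapsto> w(A u)\<close> is almost surely a bounded functional.\<close>

section \<open>Hilbert spaces\<close>

text \<open>Each instance of the last clause of \<open>white_noise\<close> concerns a single
  operator, and its null set depends on that operator. Whatever is to be known about
  \<open>w\<close> along \<open>A\<close> must therefore be encoded in one strictly positive trace
  class operator fixed before the sample point. The square root of \<open>A A'\<close>, with
  \<open>A'\<close> the adjoint, already has the range of \<open>A\<close> as its range, but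
  \<open>A A'\<close> has a kernel unless \<open>A\<close> has dense range; adding the given
  \<open>Q\<close> removes the kernel and keeps the trace finite, at the price that the range of
  \<open>A\<close> is merely contained in the new range. That is enough for the bounds. For the
  density, the laws live on an infinite-dimensional space. Linear combinations of evaluations are
  again evaluations, so the characteristic functions of single evaluations encode all joint ones,
  and Levy's one-dimensional uniqueness theorem suffices. The choice in \<open>op_sqrt\<close> is
  meaningful only once a square root is known to exist; the iteration that constructs it avoids
  spectral theory.\<close>

text \<open>The representer is the limit of a minimizing sequence of \<open>|m|^2 - 2 \<phi>(m)\<close>. As \<open>M\<close> need not be
  closed, it can be taken to be the range of an operator.\<close>

lemma riesz_subspace:
  fixes \<phi> :: "'a::{real_inner,complete_space} \<Rightarrow> real"
  assumes M: "subspace M"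
    and add: "\<And>x y. x \<in> M \<Longrightarrow> y \<in> M \<Longrightarrow> \<phi> (x + y) = \<phi> x + \<phi> y"
    and scale: "\<And>c x. x \<in> M \<Longrightarrow> \<phi> (c *\<^sub>R x) = c * \<phi> x"
    and bound: "\<And>x. x \<in> M \<Longrightarrow> \<bar>\<phi> x\<bar> \<le> C * norm x"
    and C: "0 \<le> C"
  obtains x where "x \<in> closure M" "\<And>m. m \<in> M \<Longrightarrow> x \<bullet> m = \<phi> m" "norm x \<le> C"
proof -
  define J where "J m = (norm m)\<^sup>2 - 2 * \<phi> m" for m
  define d where "d = (INF m\<in>M. J m)"
  have J_lower: "- C\<^sup>2 \<le> J m" if "m \<in> M" for m
  proof -
    have "0 \<le> (norm m - C)\<^sup>2" by simp
    then show ?thesis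
      using bound[OF that] by (simp add: J_def power2_diff algebra_simps abs_le_iff)
  qed
  have bdd: "bdd_below (J ` M)"
    using J_lower by (auto simp: bdd_below_def)
  have d_le: "d \<le> J m" if "m \<in> M" for m
    unfolding d_def using bdd that by (rule cINF_lower)
  have ne: "M \<noteq> {}" using subspace_0[OF M] by auto
  have "\<exists>m\<in>M. J m < d + inverse (Suc n)" for n
  proof -
    have "d < d + inverse (Suc n)" by simp
    then show ?thesis
      unfolding d_def using cINF_less_iff[OF ne bdd] by blast
  qed
  then obtain m where mM: "\<And>n. m n \<in> M" and mJ: "\<And>n. J (m n) < d + inverse (Suc n)"
    by metis
  \<comment> \<open>The parallelogram law makes near-minimizers close to each other, because
    \<open>J\<close> at their midpoint is still at least \<open>d\<close>.\<close>
  have para: "(norm (a - b))\<^sup>2 \<le> 2 * (J a + J b - 2 * d)" if "a \<in> M" "b \<in> M" for a b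
  proof -
    have "(1/2) *\<^sub>R (a + b) \<in> M" using that M by (simp add: subspace_add subspace_scale)
    then have "d \<le> J ((1/2) *\<^sub>R (a + b))" by (rule d_le)
    also have "\<dots> = (norm (a + b))\<^sup>2 / 4 - (\<phi> a + \<phi> b)"
      unfolding J_def scale[OF subspace_add[OF M that]] add[OF that]
      by (simp add: power_mult_distrib power_divide add_divide_distrib del: scaleR_right_distrib scaleR_add_right)
    finally have 1: "4 * d \<le> (norm (a + b))\<^sup>2 - 4 * (\<phi> a + \<phi> b)" by simp
    have "(norm (a + b))\<^sup>2 + (norm (a - b))\<^sup>2 = 2 * (norm a)\<^sup>2 + 2 * (norm b)\<^sup>2"
      by (simp add: power2_norm_eq_inner inner_diff inner_add inner_commute)
    with 1 show ?thesis by (simp add: J_def)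
  qed
  have "Cauchy m"
  proof (rule metric_CauchyI)
    fix e :: real assume e: "0 < e"
    obtain N where N: "inverse (Suc N) < e\<^sup>2 / 4"
      using reals_Archimedean[of "e\<^sup>2 / 4"] e by auto
    have "dist (m i) (m k) < e" if "i \<ge> N" "k \<ge> N" for i k
    proof -
      have le: "inverse (Suc j) \<le> inverse (Suc N)" if "j \<ge> N" for j
        using that by (simp add: field_simps)
      have "(norm (m i - m k))\<^sup>2 < e\<^sup>2"
        using para[OF mM mM, of i k] mJ[of i] mJ[of k] le[OF that(1)] le[OF that(2)] N by argo
      then show ?thesis
        using e power_less_imp_less_base[of "norm (m i - m k)" 2 e] by (simp add: dist_norm)
    qed
    then show "\<exists>N. \<forall>i\<ge>N. \<forall>k\<ge>N. dist (m i) (m k) < e" by blast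
  qed
  then obtain x where x: "m \<longlonglongrightarrow> x"
    using Cauchy_convergent_iff[of m] by (auto simp: convergent_def)
  have x_cl: "x \<in> closure M"
    using x mM closure_sequential by blast
  have Jd: "(\<lambda>n. J (m n)) \<longlonglongrightarrow> d"
  proof (rule tendsto_sandwich)
    show "\<forall>\<^sub>F n in sequentially. d \<le> J (m n)" using d_le[OF mM] by simp
    show "\<forall>\<^sub>F n in sequentially. J (m n) \<le> d + inverse (Suc n)" using mJ by (simp add: less_imp_le)
  qed (use LIMSEQ_inverse_real_of_nat_add[of d] in auto)
  have rep: "x \<bullet> v = \<phi> v" if v: "v \<in> M" for v
  proof -
    \<comment> \<open>The perturbation is applied to \<open>m n\<close> and not to the limit
      \<open>x\<close>, which may lie outside \<open>M\<close>, where nothing is known about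
      \<open>\<phi>\<close>.\<close>
    have quad: "0 \<le> 2 * t * (x \<bullet> v - \<phi> v) + t\<^sup>2 * (norm v)\<^sup>2" for t
    proof -
      have "(\<lambda>n. J (m n) + 2 * t * (m n \<bullet> v - \<phi> v) + t\<^sup>2 * (norm v)\<^sup>2)
          \<longlonglongrightarrow> d + 2 * t * (x \<bullet> v - \<phi> v) + t\<^sup>2 * (norm v)\<^sup>2"
        by (intro tendsto_intros Jd x)
      moreover have "d \<le> J (m n) + 2 * t * (m n \<bullet> v - \<phi> v) + t\<^sup>2 * (norm v)\<^sup>2" for n
      proof -
        have "d \<le> J (m n + t *\<^sub>R v)" using mM v M by (intro d_le subspace_add subspace_scale)
        also have "\<dots> = J (m n) + 2 * t * (m n \<bullet> v - \<phi> v) + t\<^sup>2 * (norm v)\<^sup>2"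
          unfolding J_def power2_norm_eq_inner
          using add[OF mM, of "t *\<^sub>R v" n] scale[OF v, of t] subspace_scale[OF M v]
          by (simp add: inner_add algebra_simps inner_commute power2_eq_square)
        finally show ?thesis .
      qed
      ultimately have "d \<le> d + 2 * t * (x \<bullet> v - \<phi> v) + t\<^sup>2 * (norm v)\<^sup>2"
        by (intro LIMSEQ_le_const) auto
      then show ?thesis by simp
    qed
    define a where "a = x \<bullet> v - \<phi> v"
    \<comment> \<open>The value \<open>- a / s\<close> of \<open>t\<close> used next is close to the
      minimizer \<open>- a / |v|^2\<close> of the quadratic; the added \<open>1\<close> avoids a
      division by zero at \<open>v = 0\<close>.\<close>
    define s where "s = (norm v)\<^sup>2 + 1"
    have "0 < s" by (simp add: s_def add_nonneg_pos)
    have "0 \<le> 2 * (- a / s) * a + (- a / s)\<^sup>2 * (s - 1)"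
      using quad[of "- a / s"] by (simp add: a_def s_def)
    also have "\<dots> = - (a / s)\<^sup>2 * (s + 1)"
      using \<open>0 < s\<close> by (simp add: field_simps power2_eq_square)
    finally have "(a / s)\<^sup>2 * (s + 1) \<le> 0" by simp
    then have "a = 0" using \<open>0 < s\<close> by (simp add: mult_le_0_iff not_le)
    then show ?thesis by (simp add: a_def)
  qed
  \<comment> \<open>\<open>rep\<close> holds on \<open>M\<close> only, so
    \<open>x \<bullet> x\<close> is reached as the limit of \<open>x \<bullet> m n\<close>.\<close>
  have "x \<bullet> x \<le> C * norm x"
  proof (rule LIMSEQ_le)
    show "(\<lambda>n. x \<bullet> m n) \<longlonglongrightarrow> x \<bullet> x" by (intro tendsto_intros x)
    show "(\<lambda>n. C * norm (m n)) \<longlonglongrightarrow> C * norm x" by (intro tendsto_intros x)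
    show "\<exists>N. \<forall>n\<ge>N. x \<bullet> m n \<le> C * norm (m n)"
      using rep[OF mM] bound[OF mM] by (metis abs_le_D1)
  qed
  then have "norm x \<le> C"
    using C by (cases "x = 0") (simp_all add: power2_eq_square flip: power2_norm_eq_inner)
  with x_cl rep that show ?thesis by blast
qed

lemma riesz_representation:
  fixes \<phi> :: "'a::{real_inner,complete_space} \<Rightarrow> real"
  assumes "bounded_linear \<phi>"
  obtains x where "\<And>v. \<phi> v = x \<bullet> v"
proof -
  interpret bounded_linear \<phi> by fact
  obtain K where K: "K \<ge> 0" "\<And>x. norm (\<phi> x) \<le> norm x * K" using nonneg_bounded by blast
  show ?thesis
    by (rule riesz_subspace[of UNIV \<phi> K])
       (use K in \<open>auto simp: add scaleR mult.commute intro: that[OF sym]\<close>)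
qed

lemma bounded_linear_adjoint:
  fixes A :: "'a::{real_inner,complete_space} \<Rightarrow> 'b::real_inner"
  assumes "bounded_linear A"
  obtains B where "bounded_linear B" "\<And>x y. A x \<bullet> y = x \<bullet> B y"
proof -
  interpret bounded_linear A by fact
  have "\<exists>b. \<forall>x. A x \<bullet> y = x \<bullet> b" for y
    using riesz_representation[of "\<lambda>x. A x \<bullet> y"]
      bounded_linear_compose[OF bounded_linear_inner_left assms] by (metis inner_commute)
  then obtain B where B: "\<And>x y. A x \<bullet> y = x \<bullet> B y" by metis
  obtain K where K: "K \<ge> 0" "\<And>x. norm (A x) \<le> norm x * K" using nonneg_bounded by blast
  have "bounded_linear B"
  proof (rule bounded_linear_intro[of _ K])
    show "B (x + y) = B x + B y" for x y
      by (simp add: vector_eq_ldot[symmetric] inner_add_right flip: B)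
    show "B (r *\<^sub>R x) = r *\<^sub>R B x" for r x
      by (simp add: vector_eq_ldot[symmetric] flip: B)
    fix y
    have "norm (B y) * norm (B y) = A (B y) \<bullet> y"
      by (simp add: B flip: power2_norm_eq_inner power2_eq_square)
    also have "\<dots> \<le> norm (A (B y)) * norm y" by (rule norm_cauchy_schwarz)
    also have "\<dots> \<le> norm (B y) * K * norm y" by (intro mult_right_mono K) auto
    finally have "norm (B y) * norm (B y) \<le> norm (B y) * (norm y * K)" by (simp add: mult_ac)
    then show "norm (B y) \<le> norm y * K"
      using K by (cases "B y = 0") auto
  qed
  with B that show ?thesis by blast
qed

section \<open>Strictly positive self-adjoint operators and their square roots\<close>

lemma inj_positive_selfadjoint:
  assumes "positive_selfadjoint Q"
  shows "inj Q"
proof -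
  interpret bounded_linear Q using assms by (simp add: positive_selfadjoint_def)
  show ?thesis
    unfolding linear_injective_0[OF linear_axioms]
    using assms unfolding positive_selfadjoint_def by (metis inner_zero_left less_irrefl)
qed

text \<open>Representing \<open>v \<mapsto> z \<bullet> v\<close> on the range gives the projection
  \<open>x\<close> of \<open>z\<close> onto the closure. By self-adjointness \<open>R\<close> kills
  \<open>x - z\<close>, so injectivity gives \<open>x = z\<close>.\<close>

lemma dense_range_positive_selfadjoint:
  fixes R :: "'a::{real_inner,complete_space} \<Rightarrow> 'a"
  assumes "positive_selfadjoint R"
  shows "closure (range R) = UNIV"
proof -
  interpret bounded_linear R using assms by (simp add: positive_selfadjoint_def)
  have sa: "R x \<bullet> y = x \<bullet> R y" for x y using assms by (simp add: positive_selfadjoint_def)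
  have "z \<in> closure (range R)" for z
  proof -
    have "subspace (range R)" using linear_subspace_image linear_axioms subspace_UNIV by blast
    then obtain x where x: "x \<in> closure (range R)" "\<And>m. m \<in> range R \<Longrightarrow> x \<bullet> m = z \<bullet> m"
      by (rule riesz_subspace[of "range R" "\<lambda>v. z \<bullet> v" "norm z"])
         (auto simp: inner_add_right Cauchy_Schwarz_ineq2)
    have "R (x - z) \<bullet> y = 0" for y
      using x(2)[of "R y"] by (simp add: sa inner_diff_left)
    then have "R (x - z) = R 0" by (simp add: zero) (metis inner_eq_zero_iff)
    then have "x - z = 0" using inj_positive_selfadjoint[OF assms] by (simp only: inj_eq)
    then show ?thesis using x(1) by simp
  qed
  then show ?thesis by auto
qed

text \<open>The conclusion says that \<open>I - S\<close> is a square root of \<open>I - T\<close>. The increments of the iteration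
  \<open>S \<mapsto> (T + S S) / 2\<close> started at \<open>0\<close> are dominated by those of \<open>b \<mapsto> (1 + b^2) / 2\<close>, which increases to \<open>1\<close>.\<close>

lemma contraction_sqrt:
  fixes T :: "'a::{real_inner,complete_space} \<Rightarrow> 'a"
  assumes T: "linear T" and Tle: "\<And>x. norm (T x) \<le> norm x" and Tsa: "\<And>x y. T x \<bullet> y = x \<bullet> T y"
  obtains S where "linear S" "\<And>x. norm (S x) \<le> norm x" "\<And>x y. S x \<bullet> y = x \<bullet> S y"
    "\<And>x. 2 *\<^sub>R S x = T x + S (S x)"
proof -
  define S where "S = rec_nat (\<lambda>x. 0) (\<lambda>_ S x. (1/2) *\<^sub>R (T x + S (S x)))"
  define b where "b = rec_nat (0::real) (\<lambda>_ b. (1 + b\<^sup>2) / 2)"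
  have S0: "S 0 x = 0" and SS: "S (Suc n) x = (1/2) *\<^sub>R (T x + S n (S n x))" for n x
    by (simp_all add: S_def)
  have b0: "b 0 = 0" and bS: "b (Suc n) = (1 + (b n)\<^sup>2) / 2" for n
    by (simp_all add: b_def)
  have b_bounds: "0 \<le> b n \<and> b n \<le> 1" for n
    by (induction n) (auto simp: b0 bS power_le_one)
  have lin: "linear (S n)" for n
  proof (induction n)
    case 0 show ?case by (rule linearI) (auto simp: S0)
  next
    case (Suc n) show ?case
      by (rule linearI)
         (auto simp: SS linear_add[OF Suc] linear_add[OF T] linear_scale[OF Suc] linear_scale[OF T] algebra_simps)
  qed
  have bd: "norm (S n x) \<le> b n * norm x" for n x
  proof (induction n arbitrary: x)
    case 0 show ?case by (simp add: S0 b0)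
  next
    case (Suc n)
    have "norm (S n (S n x)) \<le> b n * (b n * norm x)"
      using Suc[of "S n x"] mult_left_mono[OF Suc[of x], of "b n"] b_bounds[of n] by linarith
    then have "norm (T x + S n (S n x)) \<le> norm x + b n * (b n * norm x)"
      using Tle[of x] by (intro norm_triangle_mono)
    then have "norm ((1/2) *\<^sub>R (T x + S n (S n x))) \<le> (norm x + b n * (b n * norm x)) / 2" by simp
    also have "\<dots> = b (Suc n) * norm x" by (simp add: bS field_simps power2_eq_square)
    finally show ?case by (simp only: SS)
  qed
  have step: "norm (S (Suc n) x - S n x) \<le> (b (Suc n) - b n) * norm x" for n x
  proof (induction n arbitrary: x)
    case 0 show ?case using Tle[of x] by (simp add: S0 SS b0 bS)
  next
    case (Suc n)
    have d: "0 \<le> b (Suc n) - b n"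
    proof -
      have "0 \<le> (1 - b n)\<^sup>2" by simp
      then show ?thesis by (simp add: bS power2_diff field_simps)
    qed
    have 1: "norm (S (Suc n) (S (Suc n) x - S n x)) \<le> b (Suc n) * ((b (Suc n) - b n) * norm x)"
      using bd[of "Suc n" "S (Suc n) x - S n x"] mult_left_mono[OF Suc[of x], of "b (Suc n)"]
        b_bounds[of "Suc n"] by linarith
    have 2: "norm (S (Suc n) (S n x) - S n (S n x)) \<le> (b (Suc n) - b n) * (b n * norm x)"
      using Suc[of "S n x"] mult_left_mono[OF bd[of n x] d] by linarith
    \<comment> \<open>With \<open>D\<close> the increment \<open>S (Suc n) - S n\<close>, the
      difference of squares splits as \<open>S (Suc n) D + D S n\<close>; no commutation of the
      iterates is used. The scalar bounds telescope in the same way to a difference of squares of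
      \<open>b\<close>.\<close>
    have "S (Suc (Suc n)) x - S (Suc n) x =
        (1/2) *\<^sub>R (S (Suc n) (S (Suc n) x - S n x) + (S (Suc n) (S n x) - S n (S n x)))"
      unfolding SS[of "Suc n" x] SS[of n x]
      by (subst linear_diff[OF lin]) (simp add: algebra_simps SS[of n x])
    then have "norm (S (Suc (Suc n)) x - S (Suc n) x) \<le>
      (1/2) * (b (Suc n) * ((b (Suc n) - b n) * norm x) + (b (Suc n) - b n) * (b n * norm x))"
      using norm_triangle_mono[OF 1 2] by simp
    also have "\<dots> = (b (Suc (Suc n)) - b (Suc n)) * norm x"
      unfolding bS[of "Suc n"] by (subst (3) bS) (simp add: field_simps power2_eq_square)
    finally show ?case .
  qed
  have diff: "norm (S (n + k) x - S n x) \<le> (b (n + k) - b n) * norm x" for n k x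
  proof (induction k)
    case (Suc k)
    have "S (n + Suc k) x - S n x = (S (Suc (n + k)) x - S (n + k) x) + (S (n + k) x - S n x)" by simp
    then have "norm (S (n + Suc k) x - S n x) \<le>
      (b (Suc (n + k)) - b (n + k)) * norm x + (b (n + k) - b n) * norm x"
      using norm_triangle_mono[OF step[of "n + k" x] Suc] by metis
    then show ?case by (simp add: algebra_simps)
  qed simp
  have "incseq b"
  proof (rule incseq_SucI)
    fix n have "0 \<le> (1 - b n)\<^sup>2" by simp
    then show "b n \<le> b (Suc n)" by (simp add: bS power2_diff field_simps)
  qed
  then have "Cauchy b"
    using b_bounds incseq_convergent[of b 1] convergentI Cauchy_convergent_iff by metis
  have conv: "\<exists>l. (\<lambda>n. S n x) \<longlonglongrightarrow> l" for x
  proof -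
    have "Cauchy (\<lambda>n. S n x)"
    proof (rule metric_CauchyI)
      fix e :: real assume e: "0 < e"
      obtain N where N: "\<And>i k. i \<ge> N \<Longrightarrow> k \<ge> N \<Longrightarrow> dist (b i) (b k) < e / (norm x + 1)"
        using metric_CauchyD[OF \<open>Cauchy b\<close>, of "e / (norm x + 1)"] e
        by (auto simp: add_nonneg_pos)
      have le: "dist (S i x) (S k x) < e" if "i \<ge> k" "k \<ge> N" for i k
      proof -
        have "dist (S i x) (S k x) \<le> (b i - b k) * norm x"
          using diff[of k "i - k" x] that by (simp add: dist_norm)
        also have "\<dots> \<le> dist (b i) (b k) * (norm x + 1)"
          by (intro mult_mono) (auto simp: dist_real_def)
        also have "\<dots> < e" using N[of i k] that
          by (simp add: pos_less_divide_eq add_nonneg_pos)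
        finally show ?thesis .
      qed
      have "dist (S i x) (S k x) < e" if "i \<ge> N" "k \<ge> N" for i k
        using le[of i k] le[of k i] that by (cases "i \<ge> k") (auto simp: dist_commute)
      then show "\<exists>N. \<forall>i\<ge>N. \<forall>k\<ge>N. dist (S i x) (S k x) < e" by blast
    qed
    then show ?thesis using Cauchy_convergent_iff convergent_def by metis
  qed
  then obtain L where L: "\<And>x. (\<lambda>n. S n x) \<longlonglongrightarrow> L x" by metis
  have bd1: "norm (S n x) \<le> norm x" for n x
    using bd[of n x] mult_right_mono[of "b n" 1 "norm x"] b_bounds[of n] by auto
  \<comment> \<open>The iterates are uniformly bounded by \<open>1\<close>, so pointwise convergence
    passes through the composition.\<close>
  have SL: "(\<lambda>n. S n (S n x)) \<longlonglongrightarrow> L (L x)" for x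
  proof (rule Lim_transform2)
    show "(\<lambda>n. S n (L x)) \<longlonglongrightarrow> L (L x)" by (rule L)
    have "(\<lambda>n. S n x - L x) \<longlonglongrightarrow> 0" using L LIM_zero by blast
    then show "(\<lambda>n. S n (L x) - S n (S n x)) \<longlonglongrightarrow> 0"
    proof (rule Lim_transform_bound[rotated])
      have "norm (S n (L x) - S n (S n x)) \<le> norm (S n x - L x)" for n
        using bd1[of n "L x - S n x"] by (simp add: linear_diff[OF lin] norm_minus_commute)
      then show "\<forall>\<^sub>F n in sequentially. norm (S n (L x) - S n (S n x)) \<le> norm (S n x - L x)"
        by simp
    qed
  qed
  show ?thesis
  proof (rule that)
    show "linear L"
    proof (rule linearI)
      fix x y c
      have "(\<lambda>n. S n (x + y)) \<longlonglongrightarrow> L x + L y"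
        unfolding linear_add[OF lin] by (intro tendsto_intros L)
      then show "L (x + y) = L x + L y" using L LIMSEQ_unique by blast
      have "(\<lambda>n. S n (c *\<^sub>R x)) \<longlonglongrightarrow> c *\<^sub>R L x"
        unfolding linear_scale[OF lin] by (intro tendsto_intros L)
      then show "L (c *\<^sub>R x) = c *\<^sub>R L x" using L LIMSEQ_unique by blast
    qed
    show "norm (L x) \<le> norm x" for x
      using bd1 by (intro LIMSEQ_le_const2[OF tendsto_norm[OF L]]) auto
    have "S n x \<bullet> y = x \<bullet> S n y" for n x y
      by (induction n arbitrary: x y) (auto simp: S0 SS inner_add_left inner_add_right Tsa)
    then show "L x \<bullet> y = x \<bullet> L y" for x y
      using tendsto_inner[OF L tendsto_const, of x y] tendsto_inner[OF tendsto_const L, of x y]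
        LIMSEQ_unique by simp
    fix x
    have "(\<lambda>n. 2 *\<^sub>R S (Suc n) x) \<longlonglongrightarrow> 2 *\<^sub>R L x"
      by (intro tendsto_intros LIMSEQ_Suc L)
    moreover have "(\<lambda>n. 2 *\<^sub>R S (Suc n) x) \<longlonglongrightarrow> T x + L (L x)"
      by (simp add: SS) (intro tendsto_intros SL)
    ultimately show "2 *\<^sub>R L x = T x + L (L x)" by (rule LIMSEQ_unique)
  qed
qed

text \<open>Rescaling by a bound \<open>K\<close> of \<open>Q\<close> makes
  \<open>T = I - Q / K\<close> a contraction. If \<open>I - S\<close> is the square root of
  \<open>I - T = Q / K\<close>, then \<open>sqrt K\<close> times it is a square root of
  \<open>Q\<close>.\<close>

lemma positive_selfadjoint_sqrt:
  fixes Q :: "'a::{real_inner,complete_space} \<Rightarrow> 'a"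
  assumes "positive_selfadjoint Q"
  obtains R where "positive_selfadjoint R" "R \<circ> R = Q"
proof -
  have sa: "Q x \<bullet> y = x \<bullet> Q y" and pos: "x \<noteq> 0 \<Longrightarrow> 0 < Q x \<bullet> x" for x y
    using assms by (auto simp: positive_selfadjoint_def)
  interpret Q: bounded_linear Q using assms by (simp add: positive_selfadjoint_def)
  obtain K where K: "0 < K" "\<And>x. norm (Q x) \<le> norm x * K" using Q.pos_bounded by blast
  have nn: "0 \<le> Q x \<bullet> x" for x using pos[of x] by (cases "x = 0") auto
  have le: "Q x \<bullet> x \<le> K * (norm x)\<^sup>2" for x
  proof -
    have "Q x \<bullet> x \<le> norm (Q x) * norm x" by (rule norm_cauchy_schwarz)
    also have "\<dots> \<le> norm x * K * norm x" by (intro mult_right_mono K) auto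
    finally show ?thesis by (simp add: power2_eq_square mult_ac)
  qed
  \<comment> \<open>This comes from positivity of \<open>Q\<close> at \<open>x - Q x / K\<close>,
    and it is what makes \<open>T\<close> a contraction.\<close>
  have sq: "(norm (Q x))\<^sup>2 \<le> K * (Q x \<bullet> x)" for x
  proof -
    have "0 \<le> Q (x - (1/K) *\<^sub>R Q x) \<bullet> (x - (1/K) *\<^sub>R Q x)" by (rule nn)
    also have "\<dots> = Q x \<bullet> x - 2 / K * (norm (Q x))\<^sup>2 + (1/K)\<^sup>2 * (Q (Q x) \<bullet> Q x)"
      using sa[of "Q x" x] unfolding power2_norm_eq_inner
      by (simp add: Q.diff Q.scaleR inner_diff_left inner_diff_right power2_eq_square diff_divide_distrib)
    also have "\<dots> \<le> Q x \<bullet> x - 2 / K * (norm (Q x))\<^sup>2 + (1/K)\<^sup>2 * (K * (norm (Q x))\<^sup>2)"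
      using le[of "Q x"] by (intro add_left_mono mult_left_mono) auto
    also have "\<dots> = Q x \<bullet> x - (norm (Q x))\<^sup>2 / K"
      using K(1) by (simp add: field_simps power2_eq_square)
    finally show ?thesis using K(1) by (simp add: field_simps)
  qed
  define T where "T x = x - (1/K) *\<^sub>R Q x" for x
  have "linear T" unfolding T_def
    by (rule linearI) (auto simp: Q.add Q.scaleR algebra_simps)
  moreover have "norm (T x) \<le> norm x" for x
  proof -
    have "(norm (T x))\<^sup>2 = (norm x)\<^sup>2 - 2 / K * (Q x \<bullet> x) + (1/K)\<^sup>2 * (norm (Q x))\<^sup>2"
      unfolding power2_norm_eq_inner T_def
      by (simp add: inner_diff_left inner_diff_right power2_eq_square diff_divide_distrib inner_commute[of x "Q x"])
    also have "\<dots> \<le> (norm x)\<^sup>2 - 2 / K * (Q x \<bullet> x) + (1/K)\<^sup>2 * (K * (Q x \<bullet> x))"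
      using sq[of x] by (intro add_left_mono mult_left_mono) auto
    also have "\<dots> = (norm x)\<^sup>2 - 1 / K * (Q x \<bullet> x)"
      using K(1) by (simp add: field_simps power2_eq_square)
    also have "\<dots> \<le> (norm x)\<^sup>2" using K(1) nn[of x] by simp
    finally show ?thesis by (rule power2_le_imp_le) auto
  qed
  moreover have "T x \<bullet> y = x \<bullet> T y" for x y
    by (simp add: T_def inner_diff_left inner_diff_right sa)
  ultimately obtain S where S: "linear S" "\<And>x. norm (S x) \<le> norm x" "\<And>x y. S x \<bullet> y = x \<bullet> S y"
    "\<And>x. 2 *\<^sub>R S x = T x + S (S x)" by (rule contraction_sqrt) blast
  define R where "R x = sqrt K *\<^sub>R (x - S x)" for x
  have RR: "R (R x) = Q x" for x
  proof -
    have "R (R x) = (sqrt K * sqrt K) *\<^sub>R (x - 2 *\<^sub>R S x + S (S x))"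
      by (simp add: R_def linear_diff[OF S(1)] linear_scale[OF S(1)] algebra_simps scaleR_2)
    also have "\<dots> = Q x" using K(1) by (simp add: S(4) T_def)
    finally show ?thesis .
  qed
  have "bounded_linear R"
  proof (rule bounded_linear_intro[of _ "sqrt K * 2"])
    show "R (x + y) = R x + R y" for x y
      by (simp add: R_def linear_add[OF S(1)] algebra_simps)
    show "R (c *\<^sub>R x) = c *\<^sub>R R x" for c x
      by (simp add: R_def linear_scale[OF S(1)] algebra_simps)
    show "norm (R x) \<le> norm x * (sqrt K * 2)" for x
      using norm_triangle_ineq4[of x "S x"] S(2)[of x] K(1) by (simp add: R_def)
  qed
  moreover have "R x \<bullet> y = x \<bullet> R y" for x y
    by (simp add: R_def inner_diff_left inner_diff_right S(3))
  moreover have "0 < R x \<bullet> x" if "x \<noteq> 0" for x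
  proof -
    have Sx: "S x \<bullet> x \<le> (norm x)\<^sup>2"
      using norm_cauchy_schwarz[of "S x" x] mult_right_mono[OF S(2)[of x], of "norm x"]
      by (simp add: power2_eq_square)
    \<comment> \<open>Equality would make \<open>x\<close> a fixed point of the contraction
      \<open>S\<close>, hence a zero of \<open>R\<close> and of \<open>Q\<close>.\<close>
    have "S x \<bullet> x \<noteq> (norm x)\<^sup>2"
    proof
      assume eq: "S x \<bullet> x = (norm x)\<^sup>2"
      have "(norm (S x - x))\<^sup>2 = (norm (S x))\<^sup>2 - (norm x)\<^sup>2"
        using eq by (simp add: power2_norm_eq_inner inner_diff_left inner_diff_right inner_commute)
      also have "\<dots> \<le> 0" using S(2)[of x] by (simp add: power_mono)
      finally have "S x = x" by simp
      then have "Q x = 0" using RR[of x] by (simp add: R_def linear_0[OF S(1)])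
      then show False using pos[OF that] by simp
    qed
    then show ?thesis using Sx K(1) by (simp add: R_def inner_diff_left flip: power2_norm_eq_inner)
  qed
  ultimately have "positive_selfadjoint R" by (simp add: positive_selfadjoint_def)
  then show ?thesis by (rule that) (simp add: RR fun_eq_iff)
qed

lemma op_sqrt:
  fixes Q :: "'a::{real_inner,complete_space} \<Rightarrow> 'a"
  assumes "positive_selfadjoint Q"
  shows "positive_selfadjoint (op_sqrt Q)" "op_sqrt Q (op_sqrt Q x) = Q x"
proof -
  have "positive_selfadjoint (op_sqrt Q) \<and> op_sqrt Q \<circ> op_sqrt Q = Q"
    unfolding op_sqrt_def using positive_selfadjoint_sqrt[OF assms] by (metis (mono_tags, lifting) someI_ex)
  then show "positive_selfadjoint (op_sqrt Q)" "op_sqrt Q (op_sqrt Q x) = Q x"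
    by (auto simp: fun_eq_iff)
qed

section \<open>Parseval's identity and Hilbert--Schmidt sums\<close>

lemma orthonormal_inner:
  assumes "\<forall>e\<in>B. norm e = 1" "pairwise orthogonal B" "e \<in> B" "e' \<in> B"
  shows "e \<bullet> e' = (if e = e' then 1 else 0)"
  using assms by (auto simp: pairwise_def orthogonal_def simp flip: power2_norm_eq_inner)

text \<open>Finite combinations approximate \<open>x\<close> because the span is dense, and for a
  given finite \<open>F\<close> no combination does better than the one with coefficients
  \<open>x \<bullet> e\<close>; Bessel's inequality supplies the converse bound.\<close>

lemma parseval_has_sum:
  assumes B: "orthonormal_basis B"
  shows "((\<lambda>e. (x \<bullet> e)\<^sup>2) has_sum (norm x)\<^sup>2) B"
proof -
  have on: "\<forall>e\<in>B. norm e = 1" "pairwise orthogonal B" and dense: "closure (span B) = UNIV"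
    using B by (auto simp: orthonormal_basis_def)
  note ip = orthonormal_inner[OF on]
  \<comment> \<open>Keeping the coefficients \<open>c\<close> arbitrary serves twice:
    \<open>c e = x \<bullet> e\<close> gives Bessel's inequality, and dropping the last sum gives
    the optimality of these coefficients.\<close>
  have expand: "(norm (x - (\<Sum>e\<in>F. c e *\<^sub>R e)))\<^sup>2 =
      (norm x)\<^sup>2 - (\<Sum>e\<in>F. (x \<bullet> e)\<^sup>2) + (\<Sum>e\<in>F. (c e - x \<bullet> e)\<^sup>2)"
    if F: "finite F" "F \<subseteq> B" for F c
  proof -
    have "(\<Sum>e\<in>F. c e *\<^sub>R e) \<bullet> (\<Sum>e\<in>F. c e *\<^sub>R e) = (\<Sum>e\<in>F. \<Sum>e'\<in>F. if e = e' then (c e)\<^sup>2 else 0)"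
      unfolding inner_sum_left inner_sum_right
      by (intro sum.cong refl) (use F ip in \<open>auto simp: power2_eq_square subset_iff\<close>)
    also have "\<dots> = (\<Sum>e\<in>F. (c e)\<^sup>2)" using F by simp
    finally have 1: "(\<Sum>e\<in>F. c e *\<^sub>R e) \<bullet> (\<Sum>e\<in>F. c e *\<^sub>R e) = (\<Sum>e\<in>F. (c e)\<^sup>2)" .
    have "(norm (x - (\<Sum>e\<in>F. c e *\<^sub>R e)))\<^sup>2 =
       (norm x)\<^sup>2 - 2 * (\<Sum>e\<in>F. c e * (x \<bullet> e)) + (\<Sum>e\<in>F. (c e)\<^sup>2)"
      unfolding power2_norm_eq_inner inner_diff_left inner_diff_right 1
      by (simp add: inner_sum_left inner_sum_right inner_commute)
    then show ?thesis
      by (simp add: power2_diff sum.distrib sum_subtractf sum_distrib_left mult_ac)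
  qed
  have bessel: "(\<Sum>e\<in>F. (x \<bullet> e)\<^sup>2) \<le> (norm x)\<^sup>2" if F: "finite F" "F \<subseteq> B" for F
    using expand[OF F, of "\<lambda>e. x \<bullet> e"] by (simp add: diff_le_eq flip: le_diff_eq)
      (metis add.commute diff_ge_0_iff_ge zero_le_power2)
  have "\<exists>F. finite F \<and> F \<subseteq> B \<and> (norm x)\<^sup>2 - \<epsilon> < (\<Sum>e\<in>F. (x \<bullet> e)\<^sup>2)" if \<epsilon>: "\<epsilon> > 0" for \<epsilon>
  proof -
    have "x \<in> closure (span B)" by (simp add: dense)
    then obtain p where p: "p \<in> span B" "dist p x < sqrt \<epsilon>"
      unfolding closure_approachable using real_sqrt_gt_zero[OF \<epsilon>] by blast
    obtain F c where F: "finite F" "F \<subseteq> B" "p = (\<Sum>e\<in>F. c e *\<^sub>R e)"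
      using p(1) unfolding span_explicit by auto
    have "(norm x)\<^sup>2 - (\<Sum>e\<in>F. (x \<bullet> e)\<^sup>2) \<le> (norm (x - p))\<^sup>2"
      unfolding F(3) expand[OF F(1,2)] by (simp add: sum_nonneg)
    also have "\<dots> < (sqrt \<epsilon>)\<^sup>2"
      using p(2) \<epsilon> by (intro power_strict_mono) (auto simp: dist_norm norm_minus_commute)
    finally show ?thesis using F \<epsilon> by (intro exI[of _ F]) auto
  qed
  note approx = this
  let ?I = "{F. finite F \<and> F \<subseteq> B}"
  have bdd: "bdd_above ((\<lambda>F. \<Sum>e\<in>F. (x \<bullet> e)\<^sup>2) ` ?I)"
    using bessel by (auto simp: bdd_above_def)
  have "(SUP F\<in>?I. \<Sum>e\<in>F. (x \<bullet> e)\<^sup>2) = (norm x)\<^sup>2"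
  proof (rule antisym)
    show "(SUP F\<in>?I. \<Sum>e\<in>F. (x \<bullet> e)\<^sup>2) \<le> (norm x)\<^sup>2"
      using bessel by (intro cSUP_least) auto
    show "(norm x)\<^sup>2 \<le> (SUP F\<in>?I. \<Sum>e\<in>F. (x \<bullet> e)\<^sup>2)"
    proof (rule field_le_epsilon)
      fix \<epsilon> :: real assume "0 < \<epsilon>"
      then obtain F where F: "F \<in> ?I" "(norm x)\<^sup>2 - \<epsilon> < (\<Sum>e\<in>F. (x \<bullet> e)\<^sup>2)"
        using approx by blast
      then show "(norm x)\<^sup>2 \<le> (SUP F\<in>?I. \<Sum>e\<in>F. (x \<bullet> e)\<^sup>2) + \<epsilon>"
        using cSUP_upper[OF F(1) bdd] by linarith
    qed
  qed
  then show ?thesis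
    using nonneg_bdd_above_has_sum[of B "\<lambda>e. (x \<bullet> e)\<^sup>2"] bdd
    by (simp add: conj_commute)
qed

text \<open>The double sum of \<open>(A e \<bullet> f)^2\<close> can be taken in either order;
  summing over finitely many \<open>f\<close> first bounds every partial sum for \<open>A'\<close>
  by the sum for \<open>A\<close>. The basis \<open>B'\<close> is arbitrary, so that it can later be
  the one in which the trace of \<open>Q\<close> is finite.\<close>

lemma summable_on_adjoint:
  assumes "orthonormal_basis B" "(\<lambda>e. (norm (A e))\<^sup>2) summable_on B" "orthonormal_basis B'"
    and adj: "\<And>x y. A x \<bullet> y = x \<bullet> A' y"
  shows "(\<lambda>e. (norm (A' e))\<^sup>2) summable_on B'"
proof (rule nonneg_bdd_above_summable_on)
  show "bdd_above (sum (\<lambda>e. (norm (A' e))\<^sup>2) ` {F. F \<subseteq> B' \<and> finite F})"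
    unfolding bdd_above_def
  proof (intro exI ballI, clarify)
    fix F assume F: "F \<subseteq> B'" "finite F"
    have "((\<lambda>e. \<Sum>f\<in>F. (A' f \<bullet> e)\<^sup>2) has_sum (\<Sum>f\<in>F. (norm (A' f))\<^sup>2)) B"
      using F(2) parseval_has_sum[OF assms(1)] by (induction F rule: finite_induct) (auto intro!: has_sum_add)
    moreover have "((\<lambda>e. (norm (A e))\<^sup>2) has_sum (\<Sum>\<^sub>\<infinity>e\<in>B. (norm (A e))\<^sup>2)) B"
      using assms(2) by simp
    ultimately show "(\<Sum>f\<in>F. (norm (A' f))\<^sup>2) \<le> (\<Sum>\<^sub>\<infinity>e\<in>B. (norm (A e))\<^sup>2)"
    proof (rule has_sum_mono)
      fix e assume "e \<in> B"
      have "(\<Sum>f\<in>F. (A' f \<bullet> e)\<^sup>2) = (\<Sum>f\<in>F. (A e \<bullet> f)\<^sup>2)" by (simp add: adj inner_commute[of e])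
      also have "\<dots> \<le> (norm (A e))\<^sup>2"
        using parseval_has_sum[OF assms(3), of "A e"] F
        by (intro finite_sum_le_has_sum) auto
      finally show "(\<Sum>f\<in>F. (A' f \<bullet> e)\<^sup>2) \<le> (norm (A e))\<^sup>2" .
    qed
  qed
qed simp

section \<open>Characteristic functions\<close>

text \<open>Levy's theorem concerns probability measures, while the weighted measures below are
  merely finite. The value at \<open>t = 0\<close> shows that the total masses agree, so both can be
  normalized unless they vanish.\<close>

lemma distr_eq_charI:
  assumes M: "finite_measure M" and N: "finite_measure N"
    and X: "X \<in> borel_measurable M" and Y: "Y \<in> borel_measurable N"
    and char: "\<And>t. (CLINT x|M. iexp (t * X x)) = (CLINT x|N. iexp (t * Y x))"
  shows "distr M borel X = distr N borel Y"
proof -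
  interpret M: finite_measure M by fact
  interpret N: finite_measure N by fact
  define c where "c = measure M (space M)"
  have mass: "measure N (space N) = c"
    using char[of 0] by (simp add: c_def)
  show ?thesis
  proof (cases "c = 0")
    case True
    show ?thesis
    proof (rule measure_eqI)
      fix A assume "A \<in> sets (distr M borel X)"
      then have A: "A \<in> sets borel" by simp
      have "emeasure M (X -` A \<inter> space M) \<le> 0"
        using emeasure_space[of M] True by (metis M.emeasure_eq_measure c_def ennreal_0)
      moreover have "emeasure N (Y -` A \<inter> space N) \<le> 0"
        using emeasure_space[of N] True mass by (metis N.emeasure_eq_measure ennreal_0)
      ultimately show "emeasure (distr M borel X) A = emeasure (distr N borel Y) A"
        using X Y A by (simp add: emeasure_distr)
    qed simp
  next
    case False
    then have c: "0 < c" by (simp add: c_def zero_less_measure_iff)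
    have norm: "real_distribution (density (distr L borel Z) (\<lambda>_. ennreal (1 / c)))"
      if L: "finite_measure L" "Z \<in> borel_measurable L" "measure L (space L) = c" for L :: "'z measure" and Z
    proof -
      interpret L: finite_measure L by fact
      show ?thesis
        unfolding real_distribution_def real_distribution_axioms_def
        using L(2,3) c
        by (auto intro!: prob_spaceI
            simp: emeasure_density emeasure_distr L.emeasure_eq_measure simp flip: ennreal_mult')
    qed
    have chr: "char (density (distr L borel Z) (\<lambda>_. ennreal (1 / c))) t = (1 / c) *\<^sub>R (CLINT x|L. iexp (t * Z x))"
      if "Z \<in> borel_measurable L" for L :: "'z measure" and Z t
      using that c by (simp add: char_def integral_density integral_distr)
    have "density (distr M borel X) (\<lambda>_. ennreal (1 / c)) = density (distr N borel Y) (\<lambda>_. ennreal (1 / c))"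
      by (intro Levy_uniqueness norm) (use M N X Y mass char in \<open>simp_all add: c_def[symmetric] chr fun_eq_iff\<close>)
    then have "density (density (distr M borel X) (\<lambda>_. ennreal (1 / c))) (\<lambda>_. ennreal c) =
        density (density (distr N borel Y) (\<lambda>_. ennreal (1 / c))) (\<lambda>_. ennreal c)" by simp
    then show ?thesis
      using c by (simp add: density_density_eq density_1 flip: ennreal_mult')
  qed
qed

text \<open>Weighting by the nonnegative functions \<open>1 + cos f\<close> and \<open>1 + sin f\<close> makes it possible to impose
  the conditions \<open>g \<in> B\<close> one at a time with the one-dimensional uniqueness theorem.\<close>

lemma distr_trig_weight_eq:
  assumes M: "finite_measure M" and N: "finite_measure N"
    and meas: "X \<in> borel_measurable M" "Z \<in> borel_measurable M" "X' \<in> borel_measurable N" "Z' \<in> borel_measurable N"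
    and char: "\<And>s t. (CLINT x|M. iexp (s * X x + t * Z x)) = (CLINT x|N. iexp (s * X' x + t * Z' x))"
  shows "distr (density M (\<lambda>x. ennreal (1 + cos (X x)))) borel Z = distr (density N (\<lambda>x. ennreal (1 + cos (X' x)))) borel Z'"
    and "distr (density M (\<lambda>x. ennreal (1 + sin (X x)))) borel Z = distr (density N (\<lambda>x. ennreal (1 + sin (X' x)))) borel Z'"
proof -
  have fin: "finite_measure (density L (\<lambda>x. ennreal (p x)))"
    if "finite_measure L" "p \<in> borel_measurable L" "\<And>x. 0 \<le> p x" "\<And>x. p x \<le> 2" for L :: "'z measure" and p
  proof -
    interpret L: finite_measure L by fact
    have "(\<integral>\<^sup>+x. ennreal (p x) \<partial>L) \<le> (\<integral>\<^sup>+x. 2 \<partial>L)"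
      using that(4) by (intro nn_integral_mono) (metis ennreal_leI ennreal_numeral)
    also have "\<dots> < \<infinity>" by (simp add: L.emeasure_eq_measure flip: ennreal_numeral ennreal_mult')
    finally show ?thesis
      using that(2) by (intro finite_measureI) (simp add: emeasure_density)
  qed
  have int: "integrable L (\<lambda>x. iexp (h x))" if "finite_measure L" "h \<in> borel_measurable L" for L :: "'z measure" and h
    using that by (intro finite_measure.integrable_const_bound[where B=1]) auto
  \<comment> \<open>By Euler's formula each weight only shifts the frequency of \<open>a\<close> by
    \<open>0\<close>, \<open>1\<close> or \<open>-1\<close>. The coefficients \<open>0\<close> and
    \<open>1\<close> are left explicit so that the hypothesis on joint characteristic functions
    matches as it stands.\<close>
  have pw: "(1 + cos a) *\<^sub>R iexp b = iexp (0 * a + b) + (1/2) * (iexp (1 * a + b) + iexp ((-1) * a + b))"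
    "(1 + sin a) *\<^sub>R iexp b = iexp (0 * a + b) - (\<i>/2) * (iexp (1 * a + b) - iexp ((-1) * a + b))" for a b
  proof -
    have "iexp (1 * a + b) = iexp a * iexp b"
      "iexp ((-1) * a + b) = exp (- (\<i> * a)) * iexp b"
      by (simp_all add: algebra_simps flip: exp_add)
    moreover have "complex_of_real (cos a) = (iexp a + exp (- (\<i> * a))) / 2"
      "complex_of_real (sin a) = (iexp a - exp (- (\<i> * a))) / (2 * \<i>)"
      by (simp_all only: cos_exp_eq sin_exp_eq flip: cos_of_real sin_of_real)
    ultimately show "(1 + cos a) *\<^sub>R iexp b = iexp (0 * a + b) + (1/2) * (iexp (1 * a + b) + iexp ((-1) * a + b))"
      "(1 + sin a) *\<^sub>R iexp b = iexp (0 * a + b) - (\<i>/2) * (iexp (1 * a + b) - iexp ((-1) * a + b))"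
      by (simp_all only: scaleR_conv_of_real of_real_add of_real_1) (simp_all add: field_simps)
  qed
  have nn: "0 \<le> 1 + cos a" "0 \<le> 1 + sin a" for a :: real
    using cos_ge_minus_one[of a] sin_ge_minus_one[of a] by linarith+
  note integral_add = Bochner_Integration.integral_add and integral_diff = Bochner_Integration.integral_diff
    and integrable_add = Bochner_Integration.integrable_add and integrable_diff = Bochner_Integration.integrable_diff
  have int2: "integrable L (\<lambda>x. iexp (s * W x + t * V x))"
    if "finite_measure L" "W \<in> borel_measurable L" "V \<in> borel_measurable L" for L :: "'z measure" and W V s t
    using that by (intro int) auto
  have cosI: "(CLINT x|density L (\<lambda>x. ennreal (1 + cos (W x))). iexp (t * V x)) =
      (CLINT x|L. iexp (0 * W x + t * V x)) + (1/2) * ((CLINT x|L. iexp (1 * W x + t * V x)) + (CLINT x|L. iexp ((-1) * W x + t * V x)))"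
    if L: "finite_measure L" "W \<in> borel_measurable L" "V \<in> borel_measurable L" for L :: "'z measure" and W V t
  proof -
    have "(CLINT x|density L (\<lambda>x. ennreal (1 + cos (W x))). iexp (t * V x)) = (CLINT x|L. (1 + cos (W x)) *\<^sub>R iexp (t * V x))"
      by (subst integral_density) (use L nn in simp_all)
    then show ?thesis
      unfolding pw by (simp only: integral_add integrable_add integrable_mult_right int2[OF L] integral_mult_right_zero)
  qed
  have sinI: "(CLINT x|density L (\<lambda>x. ennreal (1 + sin (W x))). iexp (t * V x)) =
      (CLINT x|L. iexp (0 * W x + t * V x)) - (\<i>/2) * ((CLINT x|L. iexp (1 * W x + t * V x)) - (CLINT x|L. iexp ((-1) * W x + t * V x)))"
    if L: "finite_measure L" "W \<in> borel_measurable L" "V \<in> borel_measurable L" for L :: "'z measure" and W V t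
  proof -
    have "(CLINT x|density L (\<lambda>x. ennreal (1 + sin (W x))). iexp (t * V x)) = (CLINT x|L. (1 + sin (W x)) *\<^sub>R iexp (t * V x))"
      by (subst integral_density) (use L nn in simp_all)
    then show ?thesis
      unfolding pw by (simp only: integral_diff integrable_diff integrable_mult_right int2[OF L] integral_mult_right_zero)
  qed
  note [measurable] = meas
  have "0 \<le> 1 + cos a" "1 + cos a \<le> 2" "0 \<le> 1 + sin a" "1 + sin a \<le> 2" for a :: real
    using cos_ge_minus_one[of a] cos_le_one[of a] sin_ge_minus_one[of a] sin_le_one[of a] by linarith+
  note bounds = this
  show "distr (density M (\<lambda>x. ennreal (1 + cos (X x)))) borel Z = distr (density N (\<lambda>x. ennreal (1 + cos (X' x)))) borel Z'"
  proof (rule distr_eq_charI)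
    show "finite_measure (density M (\<lambda>x. ennreal (1 + cos (X x))))" "finite_measure (density N (\<lambda>x. ennreal (1 + cos (X' x))))"
      using M N bounds by (intro fin; simp)+
  qed (simp_all only: cosI[OF M meas(1,2)] cosI[OF N meas(3,4)] char, simp_all)
  show "distr (density M (\<lambda>x. ennreal (1 + sin (X x)))) borel Z = distr (density N (\<lambda>x. ennreal (1 + sin (X' x)))) borel Z'"
  proof (rule distr_eq_charI)
    show "finite_measure (density M (\<lambda>x. ennreal (1 + sin (X x))))" "finite_measure (density N (\<lambda>x. ennreal (1 + sin (X' x))))"
      using M N bounds by (intro fin; simp)+
  qed (simp_all only: sinI[OF M meas(1,2)] sinI[OF N meas(3,4)] char, simp_all)
qed

text \<open>Conditions \<open>X i \<in> B\<close> are added one at a time. The invariant is that,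
  after restriction to the conditions imposed so far, the integrals of \<open>iexp (X k)\<close>
  agree for every \<open>k\<close>, and not just the masses: this is what allows the next condition.
  Finite intersections of such conditions form a generator stable under intersection.\<close>

lemma measure_eq_charI:
  fixes X :: "'i \<Rightarrow> 'a \<Rightarrow> real"
  assumes M: "finite_measure M" and N: "finite_measure N" and sets: "sets N = sets M"
    and ne: "I \<noteq> {}"
    and meas: "\<And>i. i \<in> I \<Longrightarrow> X i \<in> borel_measurable M"
    and lin: "\<And>i j s t. i \<in> I \<Longrightarrow> j \<in> I \<Longrightarrow> \<exists>k\<in>I. \<forall>x\<in>space M. X k x = s * X i x + t * X j x"
    and gen: "sets M = sigma_sets (space M) {X i -` B \<inter> space M | i B. i \<in> I \<and> B \<in> sets borel}"
    and char: "\<And>i. i \<in> I \<Longrightarrow> (CLINT x|M. iexp (X i x)) = (CLINT x|N. iexp (X i x))"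
  shows "M = N"
proof -
  interpret M: finite_measure M by fact
  interpret N: finite_measure N by fact
  have space: "space N = space M" using sets by (rule sets_eq_imp_space_eq)
  have measN: "X i \<in> borel_measurable N" if "i \<in> I" for i
    using meas[OF that] sets by (simp cong: measurable_cong_sets)
  \<comment> \<open>Lists make the induction add one condition at a time, and appending them gives
    stability under intersection; the empty list gives the whole space.\<close>
  define C where "C l = {x \<in> space M. \<forall>(i, B)\<in>set l. X i x \<in> B}" for l :: "('i \<times> real set) list"
  define L where "L = {l. set l \<subseteq> I \<times> sets (borel :: real measure)}"
  have C_Cons: "C ((i, B) # l) = C l \<inter> (X i -` B \<inter> space M)" for i B l
    by (auto simp: C_def)
  have C_sets: "C l \<in> sets M" if "l \<in> L" for l
    using that
  proof (induction l)
    case (Cons p l)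
    then show ?case
      using meas by (cases p) (auto simp: C_Cons L_def intro!: sets.Int measurable_sets)
  qed (simp add: C_def)
  have "\<forall>k\<in>I. (CLINT x|M. indicator (C l) x *\<^sub>R iexp (X k x)) = (CLINT x|N. indicator (C l) x *\<^sub>R iexp (X k x))"
    if "l \<in> L" for l
    using that
  proof (induction l)
    case Nil
    have "C [] = space M" by (simp add: C_def)
    then have "(CLINT x|K. indicator (C []) x *\<^sub>R iexp (X k x)) = (CLINT x|K. iexp (X k x))" if "space K = space M" for K k
      using that by (intro Bochner_Integration.integral_cong) auto
    then show ?case using char space by simp
  next
    case (Cons p l)
    obtain i B where p: "p = (i, B)" by (cases p)
    have i: "i \<in> I" and [measurable]: "B \<in> sets borel" and l: "l \<in> L"
      using Cons.prems by (auto simp: L_def p)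
    note IH = Cons.IH[OF l]
    have [measurable]: "C l \<in> sets M" "C l \<in> sets N" using C_sets[OF l] sets by auto
    note [measurable] = meas[OF i] measN[OF i]
    let ?D = "\<lambda>K. density K (\<lambda>x. ennreal (indicator (C l) x))"
    have fin: "finite_measure (?D M)" "finite_measure (?D N)"
      by (auto intro!: finite_measureI simp: emeasure_density ennreal_indicator M.emeasure_eq_measure N.emeasure_eq_measure
          simp flip: indicator_inter_arith)
    \<comment> \<open>The condition \<open>X i \<in> B\<close> is tested on the law of
      \<open>X i\<close> under the measure restricted to \<open>C l\<close> and weighted by a
      function of \<open>X k\<close>. The joint characteristic function needed for this is covered
      by the induction hypothesis, since \<open>s * X k + t * X i\<close> is again some
      \<open>X j\<close>.\<close>
    have eq: "(LINT x|M. indicator (C (p # l)) x * (1 + cos (X k x))) = (LINT x|N. indicator (C (p # l)) x * (1 + cos (X k x)))"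
      "(LINT x|M. indicator (C (p # l)) x * (1 + sin (X k x))) = (LINT x|N. indicator (C (p # l)) x * (1 + sin (X k x)))"
      if k: "k \<in> I" for k
    proof -
      note [measurable] = meas[OF k] measN[OF k]
      have chr: "(CLINT x|?D M. iexp (s * X k x + t * X i x)) = (CLINT x|?D N. iexp (s * X k x + t * X i x))" for s t
      proof -
        obtain j where j: "j \<in> I" and jX: "\<forall>x\<in>space M. X j x = s * X k x + t * X i x"
          using lin[OF k i] by blast
        have "(CLINT x|?D K. iexp (s * X k x + t * X i x)) = (CLINT x|K. indicator (C l) x *\<^sub>R iexp (X j x))"
          if "sets K = sets M" for K
        proof -
          have [measurable]: "X k \<in> borel_measurable K" "X i \<in> borel_measurable K" "C l \<in> sets K"
            using meas[OF k] meas[OF i] C_sets[OF l] that by (simp_all cong: measurable_cong_sets)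
          show ?thesis
            using jX sets_eq_imp_space_eq[OF that]
            by (subst integral_density) (auto intro!: Bochner_Integration.integral_cong)
        qed
        then show ?thesis using IH j sets by simp
      qed
      note E = distr_trig_weight_eq[of "?D M" "?D N" "X k" "X i" "X k" "X i", OF fin _ _ _ _ chr]
      have ind: "(LINT y|distr (density (?D K) (\<lambda>x. ennreal (f (X k x)))) borel (X i). indicator B y) =
          (LINT x|K. indicator (C (p # l)) x * f (X k x))"
        if K: "sets K = sets M" and f[measurable]: "f \<in> borel_measurable borel" and nn: "\<And>x. 0 \<le> f x" for K and f :: "real \<Rightarrow> real"
      proof -
        have [measurable]: "X k \<in> borel_measurable K" "X i \<in> borel_measurable K" "C l \<in> sets K"
          using meas[OF k] meas[OF i] C_sets[OF l] K by (simp_all cong: measurable_cong_sets)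
        show ?thesis
          using nn sets_eq_imp_space_eq[OF K]
          by (simp add: integral_distr integral_density p C_Cons del: Bochner_Integration.integral_indicator)
             (auto intro!: Bochner_Integration.integral_cong simp: indicator_def)
      qed
      have nn: "0 \<le> 1 + cos a" "0 \<le> 1 + sin a" for a :: real
        using cos_ge_minus_one[of a] sin_ge_minus_one[of a] by linarith+
      show "(LINT x|M. indicator (C (p # l)) x * (1 + cos (X k x))) = (LINT x|N. indicator (C (p # l)) x * (1 + cos (X k x)))"
        using ind[of M "\<lambda>a. 1 + cos a"] ind[of N "\<lambda>a. 1 + cos a"] nn sets E(1) by simp
      show "(LINT x|M. indicator (C (p # l)) x * (1 + sin (X k x))) = (LINT x|N. indicator (C (p # l)) x * (1 + sin (X k x)))"
        using ind[of M "\<lambda>a. 1 + sin a"] ind[of N "\<lambda>a. 1 + sin a"] nn sets E(2) by simp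
    qed
    have Cs: "C (p # l) \<in> sets M" using C_sets Cons.prems by blast
    obtain z where z: "z \<in> I" "\<forall>x\<in>space M. X z x = 0"
      using lin[OF i i, of 0 0] by auto
    have split: "(LINT x|K. indicator (C (p # l)) x * (1 + f (X k x))) =
        measure K (C (p # l)) + (LINT x|K. indicator (C (p # l)) x * f (X k x))"
      and int: "integrable K (\<lambda>x. indicator (C (p # l)) x * f (X k x))"
      if K: "sets K = sets M" "finite_measure K" and k: "k \<in> I" and f[measurable]: "f \<in> borel_measurable borel" and b: "\<And>x. \<bar>f x\<bar> \<le> 1" for K k and f :: "real \<Rightarrow> real"
    proof -
      interpret K: finite_measure K by fact
      have [measurable]: "X k \<in> borel_measurable K" "C (p # l) \<in> sets K"
        using meas[OF k] Cs K(1) by (simp_all cong: measurable_cong_sets)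
      show int: "integrable K (\<lambda>x. indicator (C (p # l)) x * f (X k x))"
        using b by (intro K.integrable_const_bound[where B=1]) (auto simp: indicator_def)
      show "(LINT x|K. indicator (C (p # l)) x * (1 + f (X k x))) =
        measure K (C (p # l)) + (LINT x|K. indicator (C (p # l)) x * f (X k x))"
        using int sets.sets_into_space[of "C (p # l)" K]
        by (simp add: ring_distribs Int_absorb2 K.emeasure_eq_measure)
    qed
    note sN = split[OF sets N] and sM = split[OF refl M]
    \<comment> \<open>As \<open>X z\<close> vanishes, the weight \<open>1 + sin (X z)\<close> is
      \<open>1\<close> and yields the plain masses. Subtracting them leaves the cosine and sine
      integrals, the real and imaginary parts of the claim.\<close>
    have m: "measure M (C (p # l)) = measure N (C (p # l))"
    proof -
      have "(LINT x|K. indicator (C (p # l)) x * sin (X z x)) = 0" if "space K = space M" for K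
        using z(2) that by (subst Bochner_Integration.integral_cong[where g="\<lambda>_. 0"]) auto
      then show ?thesis using eq(2)[OF z(1)] sM[OF z(1), of sin] sN[OF z(1), of sin] space by simp
    qed
    show ?case
    proof
      fix k assume k: "k \<in> I"
      have c: "(CLINT x|K. indicator (C (p # l)) x *\<^sub>R iexp (X k x)) =
        complex_of_real (LINT x|K. indicator (C (p # l)) x * cos (X k x)) +
        \<i> * complex_of_real (LINT x|K. indicator (C (p # l)) x * sin (X k x))"
        if K: "sets K = sets M" "finite_measure K" for K
      proof -
        have "indicator (C (p # l)) x *\<^sub>R iexp (X k x) = complex_of_real (indicator (C (p # l)) x * cos (X k x)) +
          \<i> * complex_of_real (indicator (C (p # l)) x * sin (X k x))" for x
          by (simp add: scaleR_conv_of_real exp_Euler ring_distribs cos_of_real sin_of_real)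
        then show ?thesis using int[OF K k, of cos] int[OF K k, of sin]
          by (simp del: of_real_mult)
      qed
      have "(LINT x|M. indicator (C (p # l)) x * cos (X k x)) = (LINT x|N. indicator (C (p # l)) x * cos (X k x))"
        "(LINT x|M. indicator (C (p # l)) x * sin (X k x)) = (LINT x|N. indicator (C (p # l)) x * sin (X k x))"
        using eq[OF k] m sM[OF k, of cos] sN[OF k, of cos] sM[OF k, of sin] sN[OF k, of sin] by simp_all
      then show "(CLINT x|M. indicator (C (p # l)) x *\<^sub>R iexp (X k x)) = (CLINT x|N. indicator (C (p # l)) x *\<^sub>R iexp (X k x))"
        using c[OF refl M] c[OF sets N] by simp
    qed
  qed
  note ch = this
  obtain i where i: "i \<in> I" using ne by blast
  obtain z where z: "z \<in> I" "\<forall>x\<in>space M. X z x = 0" using lin[OF i i, of 0 0] by auto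
  \<comment> \<open>The invariant at the zero combination \<open>z\<close> is the equality of
    masses.\<close>
  have em: "emeasure M (C l) = emeasure N (C l)" if l: "l \<in> L" for l
  proof -
    have "(CLINT x|K. indicator (C l) x *\<^sub>R iexp (X z x)) = complex_of_real (measure K (C l))"
      if K: "sets K = sets M" "finite_measure K" for K
    proof -
      interpret K: finite_measure K by fact
      have "(CLINT x|K. indicator (C l) x *\<^sub>R iexp (X z x)) = (CLINT x|K. indicator (C l) x *\<^sub>R 1)"
        using z(2) sets_eq_imp_space_eq[OF K(1)] by (intro Bochner_Integration.integral_cong) auto
      also have "\<dots> = complex_of_real (measure K (C l))"
        using C_sets[OF l] K(1) by (subst integral_scaleR_left) (auto simp: K.emeasure_eq_measure scaleR_conv_of_real
          Int_absorb2 sets.sets_into_space)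
      finally show ?thesis .
    qed
    from this[OF refl M] this[OF sets N] ch[OF l] z(1) show ?thesis
      by (simp add: M.emeasure_eq_measure N.emeasure_eq_measure)
  qed
  show ?thesis
  proof (rule measure_eqI_generator_eq[where E="C ` L" and \<Omega>="space M" and A="\<lambda>_. space M"])
    show "Int_stable (C ` L)"
    proof (rule Int_stableI_image)
      fix l l' assume "l \<in> L" "l' \<in> L"
      then show "\<exists>k\<in>L. C l \<inter> C l' = C k"
        by (intro bexI[of _ "l @ l'"]) (auto simp: C_def L_def)
    qed
    show "C ` L \<subseteq> Pow (space M)" by (auto simp: C_def)
    have "sets M \<subseteq> sigma_sets (space M) (C ` L)"
      unfolding gen
    proof (rule sigma_sets_mono, clarify)
      fix i and B :: "real set" assume "i \<in> I" "B \<in> sets borel"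
      then have "X i -` B \<inter> space M = C [(i, B)]" "[(i, B)] \<in> L" by (auto simp: C_def L_def)
      then show "X i -` B \<inter> space M \<in> sigma_sets (space M) (C ` L)" by (metis imageI sigma_sets.Basic)
    qed
    moreover have "sigma_sets (space M) (C ` L) \<subseteq> sets M"
      using C_sets by (intro sets.sigma_sets_subset) auto
    ultimately show "sets M = sigma_sets (space M) (C ` L)" by (rule equalityI)
    with sets show "sets N = sigma_sets (space M) (C ` L)" by (rule trans)
    show "range (\<lambda>_::nat. space M) \<subseteq> C ` L"
      by (auto intro!: image_eqI[of _ _ "[]"] simp: C_def L_def)
  qed (use em in \<open>auto simp: M.emeasure_eq_measure\<close>)
qed

section \<open>Gaussian white noise\<close>

text \<open>Independence means that the joint law is the product of the marginals. Both are measures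
  on the plane, determined by their characteristic functions along the linear forms
  \<open>L p\<close>.\<close>

lemma (in prob_space) indep_var_charI:
  fixes X Y :: "'a \<Rightarrow> real"
  assumes X[measurable]: "X \<in> borel_measurable M" and Y[measurable]: "Y \<in> borel_measurable M"
    and char: "\<And>s t. (CLINT x|M. iexp (s * X x + t * Y x)) = (CLINT x|M. iexp (s * X x)) * (CLINT x|M. iexp (t * Y x))"
  shows "indep_var borel X borel Y"
proof -
  let ?N = "distr M borel X \<Otimes>\<^sub>M distr M borel Y" and ?J = "distr M (borel \<Otimes>\<^sub>M borel) (\<lambda>x. (X x, Y x))"
  define L :: "real \<times> real \<Rightarrow> real \<times> real \<Rightarrow> real" where "L p q = fst p * fst q + snd p * snd q" for p q
  interpret DX: prob_space "distr M borel X" by (rule prob_space_distr) simp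
  interpret DY: prob_space "distr M borel Y" by (rule prob_space_distr) simp
  interpret N: pair_prob_space "distr M borel X" "distr M borel Y" ..
  have sets_N: "sets ?N = sets (borel \<Otimes>\<^sub>M borel)" by (intro sets_pair_measure_cong) auto
  have space_N: "space ?N = UNIV" by (simp add: space_pair_measure)
  have L[measurable]: "L p \<in> borel_measurable (borel \<Otimes>\<^sub>M borel)" for p
    unfolding L_def by measurable
  have "?N = ?J"
  proof (rule measure_eq_charI[where I=UNIV and X=L])
    show "finite_measure ?N" by unfold_locales
    show "finite_measure ?J" by (intro prob_space.finite_measure prob_space_distr) simp
    show "sets ?J = sets ?N" by (simp add: sets_N)
    show "L p \<in> borel_measurable ?N" for p using L sets_N by (simp cong: measurable_cong_sets)
    show "\<exists>k\<in>UNIV. \<forall>x\<in>space ?N. L k x = s * L p x + t * L q x" for p q s t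
      by (intro bexI[of _ "s *\<^sub>R p + t *\<^sub>R q"]) (auto simp: L_def algebra_simps)
    let ?G = "{L i -` B \<inter> space ?N |i B. i \<in> UNIV \<and> B \<in> sets borel}"
    show "sets ?N = sigma_sets (space ?N) ?G"
    proof (rule equalityI)
      \<comment> \<open>A rectangle is an intersection of two conditions on the coordinate forms
        \<open>L (1, 0)\<close> and \<open>L (0, 1)\<close>.\<close>
      have "a \<times> b \<in> sigma_sets UNIV ?G" if "a \<in> sets borel" "b \<in> sets borel" for a b :: "real set"
      proof -
        interpret sigma_algebra UNIV "sigma_sets UNIV ?G" by (rule sigma_algebra_sigma_sets) auto
        have "L (1, 0) -` a \<in> sigma_sets UNIV ?G" "L (0, 1) -` b \<in> sigma_sets UNIV ?G"
          using that by (auto simp: space_N)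
        moreover have "a \<times> b = L (1, 0) -` a \<inter> L (0, 1) -` b" by (auto simp: L_def)
        ultimately show ?thesis by (simp only: Int)
      qed
      moreover have "sets ?N = sigma_sets UNIV {a \<times> b |a b. a \<in> sets borel \<and> b \<in> sets borel}"
        by (simp add: sets_pair_measure)
      ultimately show "sets ?N \<subseteq> sigma_sets (space ?N) ?G"
        by (simp only: space_N) (intro sigma_sets_mono, auto)
      show "sigma_sets (space ?N) ?G \<subseteq> sets ?N"
      proof (rule sets.sigma_sets_subset, clarify)
        fix p and B :: "real set" assume "B \<in> sets borel"
        moreover have "L p \<in> borel_measurable ?N" using L sets_N by (simp cong: measurable_cong_sets)
        ultimately show "L p -` B \<inter> space ?N \<in> sets ?N" by (rule measurable_sets[rotated])
      qed
    qed
    fix p :: "real \<times> real"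
    have Lm: "L p \<in> borel_measurable ?N" using L sets_N by (simp cong: measurable_cong_sets)
    have "integrable ?N (\<lambda>q. iexp (L p q))"
      using Lm by (intro N.integrable_const_bound[where B=1]) auto
    then have "(CLINT q|?N. iexp (L p q)) = (CLINT x|distr M borel X. (CLINT y|distr M borel Y. iexp (L p (x, y))))"
      by (rule N.integral_fst'[symmetric])
    also have "\<dots> = (CLINT x|distr M borel X. (CLINT y|distr M borel Y. iexp (fst p * x) * iexp (snd p * y)))"
      by (simp add: L_def ring_distribs exp_add)
    also have "\<dots> = (CLINT x|M. iexp (fst p * X x)) * (CLINT x|M. iexp (snd p * Y x))"
      by (simp add: integral_distr)
    also have "\<dots> = (CLINT q|?J. iexp (L p q))"
      by (simp only: char[symmetric]) (simp add: integral_distr L_def)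
    finally show "(CLINT q|?N. iexp (L p q)) = (CLINT q|?J. iexp (L p q))" .
  qed simp
  then show ?thesis by (simp add: indep_var_distribution_eq)
qed

lemma char_normal_density:
  assumes "0 < s"
  shows "(CLINT x|lborel. normal_density m s x *\<^sub>R iexp (t * x)) = iexp (t * m) * exp (- (s\<^sup>2 * t\<^sup>2) / 2)"
proof -
  have "(CLINT x|lborel. normal_density m s x *\<^sub>R iexp (t * x)) =
      s *\<^sub>R (CLINT x|lborel. normal_density m s (m + s * x) *\<^sub>R iexp (t * (m + s * x)))"
    using assms by (subst lborel_integral_real_affine[of s _ m]) auto
  also have "\<dots> = (CLINT x|lborel. iexp (t * m) * (std_normal_density x *\<^sub>R iexp (s * t * x)))"
    unfolding integral_scaleR_right[symmetric]
  proof (rule Bochner_Integration.integral_cong)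
    fix x
    have "s * normal_density m s (m + s * x) = std_normal_density x"
      using assms by (simp add: normal_density_def power_mult_distrib real_sqrt_mult)
    then show "s *\<^sub>R normal_density m s (m + s * x) *\<^sub>R iexp (t * (m + s * x)) =
        iexp (t * m) * (std_normal_density x *\<^sub>R iexp (s * t * x))"
      by (simp only: scaleR_scaleR) (simp add: algebra_simps flip: exp_add)
  qed simp
  also have "\<dots> = iexp (t * m) * char std_normal_distribution (s * t)"
    unfolding char_def by (simp add: integral_density del: mult_scaleR_right)
  also have "\<dots> = iexp (t * m) * exp (- (s\<^sup>2 * t\<^sup>2) / 2)"
    by (simp add: char_std_normal_distribution power_mult_distrib flip: exp_of_real)
  finally show ?thesis .
qed

text \<open>With the variance written as a second moment, the point mass at \<open>0\<close> and the
  nondegenerate case share one formula.\<close>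

lemma centered_gaussian_char:
  assumes "prob_space P" "centered_gaussian P X"
  shows "(CLINT \<omega>|P. iexp (X \<omega>)) = exp (- (\<integral>\<omega>. X \<omega> * X \<omega> \<partial>P) / 2)"
proof -
  interpret prob_space P by fact
  have X[measurable]: "X \<in> borel_measurable P" using assms(2) by (simp add: centered_gaussian_def)
  consider "AE \<omega> in P. X \<omega> = 0" | s where "s > 0" "distributed P lborel X (normal_density 0 s)"
    using assms(2) by (auto simp: centered_gaussian_def)
  then show ?thesis
  proof cases
    case 1
    have "(CLINT \<omega>|P. iexp (X \<omega>)) = (CLINT \<omega>|P. 1)" using 1 by (intro integral_cong_AE) auto
    moreover have "(\<integral>\<omega>. X \<omega> * X \<omega> \<partial>P) = (\<integral>\<omega>. 0 \<partial>P)" using 1 by (intro integral_cong_AE) auto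
    ultimately show ?thesis by (simp add: prob_space)
  next
    case (2 s)
    have "(CLINT \<omega>|P. iexp (X \<omega>)) = (CLINT x|distr P lborel X. iexp x)"
      by (subst integral_distr) auto
    also have "\<dots> = (CLINT x|lborel. normal_density 0 s x *\<^sub>R iexp (1 * x))"
      using 2 by (simp add: distributed_def integral_density)
    also have "\<dots> = exp (- s\<^sup>2 / 2)" by (subst char_normal_density[OF 2(1)]) (simp flip: exp_of_real)
    also have "s\<^sup>2 = (\<integral>\<omega>. X \<omega> * X \<omega> \<partial>P)"
      using normal_distributed_variance[OF 2(1), of X 0] normal_distributed_expectation[OF 2(1), of X 0] 2(2)
      by (simp add: power2_eq_square)
    finally show ?thesis by simp
  qed
qed

context
  fixes P :: "'w measure" and w :: "'w \<Rightarrow> 'y::real_inner \<Rightarrow> real"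
  assumes wn: "white_noise P w"
begin

interpretation prob_space P using wn by (simp add: white_noise_def)

lemma white_noise_measurable [measurable]: "(\<lambda>\<omega>. w \<omega> g) \<in> borel_measurable P"
  using wn by (simp add: white_noise_def centered_gaussian_def)

lemma white_noise_AE_linear: "AE \<omega> in P. linear (w \<omega>)"
  using wn by (simp add: white_noise_def)

lemma white_noise_AE_comb: "AE \<omega> in P. w \<omega> (a *\<^sub>R g + b *\<^sub>R h) = a * w \<omega> g + b * w \<omega> h"
  using white_noise_AE_linear by eventually_elim (simp add: linear_add linear_scale)

lemma white_noise_char: "(CLINT \<omega>|P. iexp (w \<omega> g)) = exp (- (norm g)\<^sup>2 / 2)"
  using wn centered_gaussian_char[OF prob_space_axioms, of "\<lambda>\<omega>. w \<omega> g"]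
  by (simp add: white_noise_def power2_norm_eq_inner)

lemma white_noise_distributed:
  assumes "b \<noteq> 0"
  shows "distributed P lborel (\<lambda>\<omega>. w \<omega> b) (normal_density 0 (norm b))"
proof -
  have sq: "(\<integral>\<omega>. w \<omega> b * w \<omega> b \<partial>P) = (norm b)\<^sup>2"
    using wn by (simp add: white_noise_def power2_norm_eq_inner)
  have "\<not> (AE \<omega> in P. w \<omega> b = 0)"
  proof
    assume "AE \<omega> in P. w \<omega> b = 0"
    then have "(\<integral>\<omega>. w \<omega> b * w \<omega> b \<partial>P) = (\<integral>\<omega>. 0 \<partial>P)" by (intro integral_cong_AE) auto
    then show False using sq assms by simp
  qed
  then obtain s where s: "s > 0" "distributed P lborel (\<lambda>\<omega>. w \<omega> b) (normal_density 0 s)"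
    using wn by (auto simp: white_noise_def centered_gaussian_def)
  then have "s\<^sup>2 = (norm b)\<^sup>2"
    using normal_distributed_variance[OF s(1), of "\<lambda>\<omega>. w \<omega> b" 0] normal_distributed_expectation[OF s(1), of "\<lambda>\<omega>. w \<omega> b" 0] sq
    by (simp add: power2_eq_square)
  then have "s = norm b" using s(1) by (simp add: power2_eq_iff_nonneg)
  then show ?thesis using s by simp
qed

section \<open>Exponential tilts of white noise\<close>

lemma white_noise_tilted_line:
  assumes b: "b \<noteq> 0"
  shows "integrable P (\<lambda>\<omega>. exp (w \<omega> b - (norm b)\<^sup>2 / 2))"
    and "(CLINT \<omega>|P. exp (w \<omega> b - (norm b)\<^sup>2 / 2) *\<^sub>R iexp (t * w \<omega> b)) =
      iexp (t * (norm b)\<^sup>2) * exp (- ((norm b)\<^sup>2 * t\<^sup>2) / 2)"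
proof -
  let ?s = "norm b"
  have s: "?s > 0" using b by simp
  note D = white_noise_distributed[OF b]
  \<comment> \<open>Completing the square: the tilt moves the mean of the centered normal law to
    \<open>?s^2\<close> and keeps its variance.\<close>
  have dens: "normal_density 0 ?s x * exp (x - ?s\<^sup>2 / 2) = normal_density (?s\<^sup>2) ?s x" for x
  proof -
    have "- (x - 0)\<^sup>2 / (2 * ?s\<^sup>2) + (x - ?s\<^sup>2 / 2) = - (x - ?s\<^sup>2)\<^sup>2 / (2 * ?s\<^sup>2)"
      using s by (simp add: field_simps power2_eq_square)
    then show ?thesis by (simp add: normal_density_def flip: exp_add)
  qed
  have d: "distr P lborel (\<lambda>\<omega>. w \<omega> b) = density lborel (normal_density 0 ?s)"
    using D by (simp add: distributed_def)
  have "integrable (distr P lborel (\<lambda>\<omega>. w \<omega> b)) (\<lambda>x. exp (x - ?s\<^sup>2 / 2))"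
    unfolding d using integrable_normal_density[OF s, of "?s\<^sup>2"]
    by (subst integrable_density) (auto simp: dens)
  then show "integrable P (\<lambda>\<omega>. exp (w \<omega> b - ?s\<^sup>2 / 2))"
    by (subst (asm) integrable_distr_eq) auto
  have "(CLINT \<omega>|P. exp (w \<omega> b - ?s\<^sup>2 / 2) *\<^sub>R iexp (t * w \<omega> b)) =
      (CLINT x|distr P lborel (\<lambda>\<omega>. w \<omega> b). exp (x - ?s\<^sup>2 / 2) *\<^sub>R iexp (t * x))"
    by (subst integral_distr) auto
  also have "\<dots> = (CLINT x|lborel. normal_density (?s\<^sup>2) ?s x *\<^sub>R iexp (t * x))"
    unfolding d by (subst integral_density) (auto simp: dens)
  also have "\<dots> = iexp (t * ?s\<^sup>2) * exp (- (?s\<^sup>2 * t\<^sup>2) / 2)"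
    by (rule char_normal_density[OF s])
  finally show "(CLINT \<omega>|P. exp (w \<omega> b - ?s\<^sup>2 / 2) *\<^sub>R iexp (t * w \<omega> b)) = \<dots>" .
qed

text \<open>Almost sure linearity turns the combination into \<open>w\<close> at a single vector,
  and by Pythagoras its variance is the sum of the two. This also shows that no separate assumption
  of joint Gaussianity is involved.\<close>

lemma white_noise_char_comb:
  assumes "h \<bullet> b = 0"
  shows "(CLINT \<omega>|P. iexp (s * w \<omega> h + t * w \<omega> b)) =
    (CLINT \<omega>|P. iexp (s * w \<omega> h)) * (CLINT \<omega>|P. iexp (t * w \<omega> b))"
proof -
  have one: "(CLINT \<omega>|P. iexp (s * w \<omega> g)) = exp (- (s\<^sup>2 * (norm g)\<^sup>2) / 2)" for s g
  proof -
    have "(CLINT \<omega>|P. iexp (s * w \<omega> g)) = (CLINT \<omega>|P. iexp (w \<omega> (s *\<^sub>R g)))"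
      using white_noise_AE_comb[of s g 0 0] by (intro integral_cong_AE) auto
    then show ?thesis by (simp add: white_noise_char power_mult_distrib)
  qed
  have "(CLINT \<omega>|P. iexp (s * w \<omega> h + t * w \<omega> b)) = (CLINT \<omega>|P. iexp (w \<omega> (s *\<^sub>R h + t *\<^sub>R b)))"
    using white_noise_AE_comb[of s h t b] by (intro integral_cong_AE) auto
  also have "\<dots> = exp (- (norm (s *\<^sub>R h + t *\<^sub>R b))\<^sup>2 / 2)" by (rule white_noise_char)
  also have "(norm (s *\<^sub>R h + t *\<^sub>R b))\<^sup>2 = s\<^sup>2 * (norm h)\<^sup>2 + t\<^sup>2 * (norm b)\<^sup>2"
    using assms unfolding power2_norm_eq_inner
    by (simp add: inner_add inner_commute power2_eq_square)
  also have "complex_of_real (exp (- (s\<^sup>2 * (norm h)\<^sup>2 + t\<^sup>2 * (norm b)\<^sup>2) / 2)) =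
     complex_of_real (exp (- (s\<^sup>2 * (norm h)\<^sup>2) / 2)) * complex_of_real (exp (- (t\<^sup>2 * (norm b)\<^sup>2) / 2))"
    by (simp add: add_divide_distrib diff_divide_distrib flip: exp_add of_real_mult)
  finally show ?thesis by (simp only: one)
qed

text \<open>Split \<open>g = h + a b\<close> with \<open>h\<close> orthogonal to \<open>b\<close>.
  Then \<open>w(h)\<close> is independent of \<open>w(b)\<close> and unaffected by the tilt, so only
  the one-dimensional computation along \<open>b\<close> remains.\<close>

lemma white_noise_tilted_char:
  "(CLINT \<omega>|P. exp (w \<omega> b - (norm b)\<^sup>2 / 2) *\<^sub>R iexp (w \<omega> g)) = iexp (b \<bullet> g) * exp (- (norm g)\<^sup>2 / 2)"
proof (cases "b = 0")
  case True
  have "AE \<omega> in P. w \<omega> b = 0" using white_noise_AE_linear by eventually_elim (simp add: True linear_0)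
  then have "(CLINT \<omega>|P. exp (w \<omega> b - (norm b)\<^sup>2 / 2) *\<^sub>R iexp (w \<omega> g)) = (CLINT \<omega>|P. iexp (w \<omega> g))"
    using True by (intro integral_cong_AE) auto
  then show ?thesis using True by (simp add: white_noise_char)
next
  case False
  define a where "a = (b \<bullet> g) / (norm b)\<^sup>2"
  define h where "h = g - a *\<^sub>R b"
  have a: "a * (norm b)\<^sup>2 = b \<bullet> g" using False by (simp add: a_def)
  have hb: "h \<bullet> b = 0"
    using a unfolding power2_norm_eq_inner by (simp add: h_def inner_diff_left inner_commute[of g])
  have g: "g = 1 *\<^sub>R h + a *\<^sub>R b" by (simp add: h_def)
  have norm_g: "(norm g)\<^sup>2 = (norm h)\<^sup>2 + (norm b)\<^sup>2 * a\<^sup>2"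
    using hb unfolding power2_norm_eq_inner
    by (subst (1 2) g) (simp add: inner_add inner_commute power2_eq_square)
  define F where "F x = exp (x - (norm b)\<^sup>2 / 2) *\<^sub>R iexp (a * x)" for x :: real
  have [measurable]: "F \<in> borel_measurable borel" unfolding F_def by measurable
  have "indep_var borel (\<lambda>\<omega>. w \<omega> h) borel (\<lambda>\<omega>. w \<omega> b)"
    using white_noise_char_comb[OF hb] by (intro indep_var_charI) auto
  then have ind: "indep_var borel (iexp \<circ> (\<lambda>\<omega>. w \<omega> h)) borel (F \<circ> (\<lambda>\<omega>. w \<omega> b))"
    by (rule indep_var_compose) auto
  have int: "integrable P (\<lambda>\<omega>. F (w \<omega> b))"
    by (rule Bochner_Integration.integrable_bound[OF white_noise_tilted_line(1)[OF False]]) (auto simp: F_def)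
  have "(CLINT \<omega>|P. exp (w \<omega> b - (norm b)\<^sup>2 / 2) *\<^sub>R iexp (w \<omega> g)) = (CLINT \<omega>|P. iexp (w \<omega> h) * F (w \<omega> b))"
  proof (intro integral_cong_AE)
    show "AE \<omega> in P. exp (w \<omega> b - (norm b)\<^sup>2 / 2) *\<^sub>R iexp (w \<omega> g) = iexp (w \<omega> h) * F (w \<omega> b)"
      using white_noise_AE_comb[of 1 h a b] unfolding g[symmetric]
      by eventually_elim (simp add: F_def ring_distribs exp_add)
  qed auto
  also have "\<dots> = (CLINT \<omega>|P. iexp (w \<omega> h)) * (CLINT \<omega>|P. F (w \<omega> b))"
    by (rule indep_var_lebesgue_integral[OF ind, unfolded o_def, OF integrable_const_bound[where B=1] int]) auto
  also have "\<dots> = iexp (b \<bullet> g) * exp (- (norm g)\<^sup>2 / 2)"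
  proof -
    have "complex_of_real (exp (- ((norm h)\<^sup>2 + (norm b)\<^sup>2 * a\<^sup>2) / 2)) =
        complex_of_real (exp (- (norm h)\<^sup>2 / 2)) * complex_of_real (exp (- ((norm b)\<^sup>2 * a\<^sup>2) / 2))"
      by (simp add: add_divide_distrib diff_divide_distrib flip: exp_add of_real_mult)
    then show ?thesis
      unfolding F_def white_noise_tilted_line(2)[OF False] white_noise_char a norm_g
      by (simp only: mult_ac)
  qed
  finally show ?thesis .
qed

lemma white_noise_tilt_integrable: "integrable P (\<lambda>\<omega>. exp (w \<omega> b - (norm b)\<^sup>2 / 2))"
proof (cases "b = 0")
  case True
  have "AE \<omega> in P. w \<omega> b = 0" using white_noise_AE_linear by eventually_elim (simp add: True linear_0)
  then show ?thesis
    by (intro integrable_const_bound[where B=1]) (use True in auto)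
qed (rule white_noise_tilted_line(1))

end

section \<open>The dual of the range of the square root\<close>

lemma op_sqrt_in_range [simp]: "op_sqrt Q x \<in> sqrt_range Q"
  by (simp add: sqrt_range_def)

context
  fixes Q :: "'y::{real_inner,polish_space} \<Rightarrow> 'y"
  assumes Q: "positive_selfadjoint Q"
begin

interpretation R: bounded_linear "op_sqrt Q"
  using op_sqrt(1)[OF Q] by (simp add: positive_selfadjoint_def)

lemma inj_op_sqrt: "inj (op_sqrt Q)"
  by (rule inj_positive_selfadjoint[OF op_sqrt(1)[OF Q]])

lemma subspace_sqrt_range: "subspace (sqrt_range Q)"
  unfolding sqrt_range_def by (intro linear_subspace_image R.linear_axioms subspace_UNIV)

lemma sqrt_range_norm_op_sqrt [simp]: "sqrt_range_norm Q (op_sqrt Q x) = norm x"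
  by (simp add: sqrt_range_norm_def inj_op_sqrt)

lemma closure_sqrt_range: "closure (sqrt_range Q) = UNIV"
  unfolding sqrt_range_def by (rule dense_range_positive_selfadjoint[OF op_sqrt(1)[OF Q]])

text \<open>\<open>op_sqrt Q\<close> is an isometry from \<open>Y\<close> onto \<open>V\<close> with
  its Hilbert norm. Pulling functionals back along it replaces the dual of \<open>V\<close> by the
  dual of \<open>Y\<close>, where the Riesz representation is available.\<close>

lemma mem_sqrt_range_dual_iff:
  "f \<in> sqrt_range_dual Q \<longleftrightarrow> f \<in> extensional (sqrt_range Q) \<and> bounded_linear (\<lambda>x. f (op_sqrt Q x))"
proof
  assume f: "f \<in> sqrt_range_dual Q"
  then obtain C where C: "\<And>x. \<bar>f (op_sqrt Q x)\<bar> \<le> C * norm x"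
    unfolding sqrt_range_dual_def by (auto simp: sqrt_range_def)
  have "bounded_linear (\<lambda>x. f (op_sqrt Q x))"
    using f by (intro bounded_linear_intro[of _ C])
      (auto simp: sqrt_range_dual_def R.add R.scaleR C mult.commute)
  with f show "f \<in> extensional (sqrt_range Q) \<and> bounded_linear (\<lambda>x. f (op_sqrt Q x))"
    by (simp add: sqrt_range_dual_def)
next
  assume f: "f \<in> extensional (sqrt_range Q) \<and> bounded_linear (\<lambda>x. f (op_sqrt Q x))"
  then interpret f: bounded_linear "\<lambda>x. f (op_sqrt Q x)" by simp
  obtain K where K: "\<And>x. norm (f (op_sqrt Q x)) \<le> norm x * K" using f.bounded by blast
  show "f \<in> sqrt_range_dual Q"
    unfolding sqrt_range_dual_def
  proof (intro CollectI conjI ballI allI)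
    show "f (u + v) = f u + f v" if "u \<in> sqrt_range Q" "v \<in> sqrt_range Q" for u v
      using that f.add by (auto simp: sqrt_range_def R.add[symmetric])
    show "f (c *\<^sub>R v) = c * f v" if "v \<in> sqrt_range Q" for c v
      using that f.scaleR by (auto simp: sqrt_range_def R.scaleR[symmetric])
    show "\<exists>C. \<forall>v\<in>sqrt_range Q. \<bar>f v\<bar> \<le> C * sqrt_range_norm Q v"
      using K by (intro exI[of _ K]) (auto simp: sqrt_range_def mult.commute)
  qed (use f in simp)
qed

lemma sqrt_range_dual_riesz:
  assumes "f \<in> sqrt_range_dual Q"
  obtains y where "\<And>x. f (op_sqrt Q x) = y \<bullet> x"
  using riesz_representation[of "\<lambda>x. f (op_sqrt Q x)"] assms by (auto simp: mem_sqrt_range_dual_iff)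

lemma sqrt_range_dual_norm_le:
  assumes "\<And>x. \<bar>h (op_sqrt Q x)\<bar> \<le> c * norm x" "0 \<le> c"
  shows "sqrt_range_dual_norm Q h \<le> c"
  unfolding sqrt_range_dual_norm_def
proof (rule cSUP_least)
  have "op_sqrt Q 0 \<in> {v \<in> sqrt_range Q. sqrt_range_norm Q v \<le> 1}" by (simp del: R.zero)
  then show "{v \<in> sqrt_range Q. sqrt_range_norm Q v \<le> 1} \<noteq> {}" by blast
  fix v assume "v \<in> {v \<in> sqrt_range Q. sqrt_range_norm Q v \<le> 1}"
  then obtain x where x: "v = op_sqrt Q x" "norm x \<le> 1" by (auto simp: sqrt_range_def)
  have "\<bar>h v\<bar> \<le> c * norm x" using assms(1) x by simp
  also have "\<dots> \<le> c" using x assms(2) by (simp add: mult_left_le)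
  finally show "\<bar>h v\<bar> \<le> c" .
qed

text \<open>The hypothesis concerns only the pullback of \<open>h\<close>, because a pointwise
  difference of two dual elements need not be extensional. Boundedness ensures that the supremum in
  the norm is over a set bounded above.\<close>

lemma abs_le_sqrt_range_dual_norm:
  assumes "bounded_linear (\<lambda>x. h (op_sqrt Q x))"
  shows "\<bar>h (op_sqrt Q x)\<bar> \<le> sqrt_range_dual_norm Q h * norm x"
proof (cases "x = 0")
  case True
  interpret h: bounded_linear "\<lambda>x. h (op_sqrt Q x)" by fact
  show ?thesis using h.zero True by simp
next
  case False
  interpret h: bounded_linear "\<lambda>x. h (op_sqrt Q x)" by fact
  obtain K where K: "0 \<le> K" "\<And>x. norm (h (op_sqrt Q x)) \<le> norm x * K" using h.nonneg_bounded by blast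
  let ?x = "(1 / norm x) *\<^sub>R x"
  have "\<bar>h (op_sqrt Q ?x)\<bar> \<le> sqrt_range_dual_norm Q h"
    unfolding sqrt_range_dual_norm_def
  proof (rule cSUP_upper)
    show "op_sqrt Q ?x \<in> {v \<in> sqrt_range Q. sqrt_range_norm Q v \<le> 1}"
      using False by (simp del: R.scaleR)
    show "bdd_above ((\<lambda>v. \<bar>h v\<bar>) ` {v \<in> sqrt_range Q. sqrt_range_norm Q v \<le> 1})"
      unfolding bdd_above_def
    proof (intro exI ballI, clarify)
      fix v assume "v \<in> sqrt_range Q" "sqrt_range_norm Q v \<le> 1"
      then obtain x where x: "v = op_sqrt Q x" "norm x \<le> 1" by (auto simp: sqrt_range_def)
      have "\<bar>h v\<bar> \<le> norm x * K" using K(2)[of x] x by simp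
      also have "\<dots> \<le> K" using x K(1) by (simp add: mult_left_le_one_le)
      finally show "\<bar>h v\<bar> \<le> K" .
    qed
  qed
  moreover have "h (op_sqrt Q ?x) = (1 / norm x) * h (op_sqrt Q x)" using h.scaleR[of "1 / norm x" x] by simp
  ultimately show ?thesis using False by (simp add: field_simps abs_mult)
qed

section \<open>Borel sets of the dual\<close>

definition dual_open :: "('y \<Rightarrow> real) set set" where
  "dual_open = {U. U \<subseteq> sqrt_range_dual Q \<and>
         (\<forall>f\<in>U. \<exists>\<epsilon>>0. \<forall>g\<in>sqrt_range_dual Q.
            sqrt_range_dual_norm Q (\<lambda>v. g v - f v) < \<epsilon> \<longrightarrow> g \<in> U)}"

lemma space_dual_borel [simp]: "space (sqrt_range_dual_borel Q) = sqrt_range_dual Q"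
  by (simp add: sqrt_range_dual_borel_def space_measure_of_conv)

lemma sets_dual_borel_open: "sets (sqrt_range_dual_borel Q) = sigma_sets (sqrt_range_dual Q) dual_open"
  unfolding sqrt_range_dual_borel_def dual_open_def by (rule sets_measure_of) auto

lemma sqrt_range_dual_diff_bounded_linear:
  assumes "f \<in> sqrt_range_dual Q" "g \<in> sqrt_range_dual Q"
  shows "bounded_linear (\<lambda>x. g (op_sqrt Q x) - f (op_sqrt Q x))"
  using assms by (intro bounded_linear_sub) (simp_all add: mem_sqrt_range_dual_iff)

lemma measurable_dual_eval [measurable]:
  assumes v: "v \<in> sqrt_range Q"
  shows "(\<lambda>f. f v) \<in> borel_measurable (sqrt_range_dual_borel Q)"
proof (rule borel_measurableI)
  fix S :: "real set" assume "open S"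
  obtain x where x: "v = op_sqrt Q x" using v by (auto simp: sqrt_range_def)
  have "(\<lambda>f. f v) -` S \<inter> sqrt_range_dual Q \<in> dual_open"
    unfolding dual_open_def
  proof (intro CollectI conjI ballI)
    fix f assume f: "f \<in> (\<lambda>f. f v) -` S \<inter> sqrt_range_dual Q"
    then obtain \<delta> where \<delta>: "\<delta> > 0" "\<And>r. dist r (f v) < \<delta> \<Longrightarrow> r \<in> S"
      using \<open>open S\<close> by (auto simp: open_dist)
    show "\<exists>\<epsilon>>0. \<forall>g\<in>sqrt_range_dual Q. sqrt_range_dual_norm Q (\<lambda>v. g v - f v) < \<epsilon> \<longrightarrow> g \<in> (\<lambda>f. f v) -` S \<inter> sqrt_range_dual Q"
    \<comment> \<open>The summand \<open>1\<close> keeps the radius meaningful when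
      \<open>x = 0\<close>.\<close>
    proof (intro exI[of _ "\<delta> / (norm x + 1)"] conjI ballI impI)
      show "0 < \<delta> / (norm x + 1)" using \<delta>(1) by (simp add: add_nonneg_pos)
      fix g assume g: "g \<in> sqrt_range_dual Q" and l: "sqrt_range_dual_norm Q (\<lambda>v. g v - f v) < \<delta> / (norm x + 1)"
      have "\<bar>g v - f v\<bar> \<le> sqrt_range_dual_norm Q (\<lambda>v. g v - f v) * norm x"
        using abs_le_sqrt_range_dual_norm[of "\<lambda>v. g v - f v" x] sqrt_range_dual_diff_bounded_linear[of f g] f g x by simp
      also have "\<dots> \<le> \<delta> / (norm x + 1) * norm x" using l by (intro mult_right_mono) auto
      also have "\<dots> < \<delta>" using \<delta>(1) by (simp add: pos_divide_less_eq add_nonneg_pos)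
      finally show "g \<in> (\<lambda>f. f v) -` S \<inter> sqrt_range_dual Q"
        using g \<delta>(2)[of "g v"] by (simp add: dist_real_def)
    qed
  qed auto
  then show "(\<lambda>f. f v) -` S \<inter> space (sqrt_range_dual_borel Q) \<in> sets (sqrt_range_dual_borel Q)"
    by (simp add: sets_dual_borel_open sigma_sets.Basic)
qed

text \<open>The Riesz isomorphism makes the dual separable, so that an open set is a countable union of
  closed balls; these are intersections of countably many conditions on evaluations.\<close>

lemma sets_dual_borel_eval:
  "sets (sqrt_range_dual_borel Q) =
    sigma_sets (sqrt_range_dual Q) {(\<lambda>f. f v) -` B \<inter> sqrt_range_dual Q | v B. v \<in> sqrt_range Q \<and> B \<in> sets borel}"
  (is "_ = sigma_sets ?V ?E")
proof (rule equalityI)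
  show "sigma_sets ?V ?E \<subseteq> sets (sqrt_range_dual_borel Q)"
    using sets.sigma_sets_subset[of ?E "sqrt_range_dual_borel Q"] measurable_sets[OF measurable_dual_eval]
    by auto
  have E: "sigma_sets ?V ?E = sets (sigma ?V ?E)"
    by (intro sets_measure_of[symmetric]) auto
  obtain D :: "'y set" where D: "countable D" "\<And>X. open X \<Longrightarrow> X \<noteq> {} \<Longrightarrow> \<exists>d\<in>D. d \<in> X"
    using countable_dense_setE by blast
  have closD: "closure D = UNIV"
  proof -
    have "x \<in> closure D" for x
      unfolding closure_approachable
    proof (intro allI impI)
      fix e :: real assume "e > 0"
      then show "\<exists>y\<in>D. dist y x < e" using D(2)[of "ball x e"] by (auto simp: dist_commute)
    qed
    then show ?thesis by auto
  qed
  \<comment> \<open>The closed ball of radius \<open>q\<close> around the functional with Riesz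
    representer \<open>d\<close>, written with pointwise inequalities instead of a supremum.\<close>
  define cb where "cb d q = {g \<in> ?V. \<forall>x. \<bar>g (op_sqrt Q x) - d \<bullet> x\<bar> \<le> q * norm x}" for d q
  have cb_sets: "cb d q \<in> sigma_sets ?V ?E" for d q
  proof -
    \<comment> \<open>Since the pullback of \<open>g\<close> is continuous, the inequalities on the
      countable dense set \<open>D\<close> imply all the others.\<close>
    have "cb d q = ?V \<inter> (\<Inter>x\<in>D. {g \<in> ?V. \<bar>g (op_sqrt Q x) - d \<bullet> x\<bar> \<le> q * norm x})" (is "_ = ?rhs")
    proof (intro equalityI subsetI)
      fix g assume g: "g \<in> ?rhs"
      then obtain y where y: "\<And>x. g (op_sqrt Q x) = y \<bullet> x" using sqrt_range_dual_riesz by blast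
      let ?C = "{x. \<bar>y \<bullet> x - d \<bullet> x\<bar> \<le> q * norm x}"
      have "closed ?C" by (intro closed_Collect_le continuous_intros)
      moreover have "D \<subseteq> ?C"
      proof
        fix x assume "x \<in> D"
        then have "\<bar>g (op_sqrt Q x) - d \<bullet> x\<bar> \<le> q * norm x" using g by blast
        then show "x \<in> ?C" by (simp add: y)
      qed
      ultimately have "closure D \<subseteq> ?C" by (rule closure_minimal[rotated])
      then have "\<bar>y \<bullet> x - d \<bullet> x\<bar> \<le> q * norm x" for x using closD by blast
      moreover have "g \<in> ?V" using g by blast
      ultimately show "g \<in> cb d q" unfolding cb_def y mem_Collect_eq by blast
    next
      fix g assume "g \<in> cb d q"
      then show "g \<in> ?rhs" unfolding cb_def by blast
    qed
    moreover have "?rhs \<in> sigma_sets ?V ?E"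
    proof (cases "D = {}")
      case False
      have "{g \<in> ?V. \<bar>g (op_sqrt Q x) - d \<bullet> x\<bar> \<le> q * norm x} \<in> sigma_sets ?V ?E" for x
      proof -
        have "{g \<in> ?V. \<bar>g (op_sqrt Q x) - d \<bullet> x\<bar> \<le> q * norm x} = (\<lambda>f. f (op_sqrt Q x)) -` {r. \<bar>r - d \<bullet> x\<bar> \<le> q * norm x} \<inter> ?V"
          by auto
        moreover have "{r. \<bar>r - d \<bullet> x\<bar> \<le> q * norm x} \<in> sets borel" by measurable
        ultimately show ?thesis using op_sqrt_in_range[of Q x] by (intro sigma_sets.Basic CollectI exI conjI)
      qed
      then have "(\<Inter>x\<in>D. {g \<in> ?V. \<bar>g (op_sqrt Q x) - d \<bullet> x\<bar> \<le> q * norm x}) \<in> sigma_sets ?V ?E"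
        using False D(1) unfolding E by (intro sets.countable_INT') auto
      moreover have "?V \<in> sigma_sets ?V ?E" by (rule sigma_sets_top)
      ultimately show ?thesis unfolding E by (intro sets.Int)
    qed (simp add: sigma_sets_top)
    ultimately show ?thesis by simp
  qed
  show "sets (sqrt_range_dual_borel Q) \<subseteq> sigma_sets ?V ?E"
    unfolding sets_dual_borel_open
  proof (rule sigma_sets_mono, rule subsetI)
    fix U assume U: "U \<in> dual_open"
    let ?I = "{p \<in> D \<times> \<rat>. cb (fst p) (snd p) \<subseteq> U}"
    have U_eq: "U = (\<Union>p\<in>?I. cb (fst p) (snd p))"
    proof (intro equalityI subsetI)
      fix f assume f: "f \<in> U"
      then obtain \<epsilon> where \<epsilon>: "\<epsilon> > 0" and ball: "\<And>g. g \<in> ?V \<Longrightarrow> sqrt_range_dual_norm Q (\<lambda>v. g v - f v) < \<epsilon> \<Longrightarrow> g \<in> U"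
        using U unfolding dual_open_def by blast
      have fV: "f \<in> ?V" using U f by (auto simp: dual_open_def)
      obtain y where y: "\<And>x. f (op_sqrt Q x) = y \<bullet> x" using sqrt_range_dual_riesz[OF fV] by blast
      \<comment> \<open>Half of \<open>\<epsilon>\<close> is needed because \<open>f\<close> and any
        \<open>g\<close> in \<open>cb d q\<close> both lie within \<open>q\<close> of
        \<open>d\<close>, hence within \<open>2 * q\<close> of each other.\<close>
      obtain q where q: "q \<in> \<rat>" "0 < q" "q < \<epsilon> / 2" using Rats_dense_in_real[of 0 "\<epsilon> / 2"] \<epsilon> by auto
      obtain d where d: "d \<in> D" "d \<in> ball y q" using D(2)[of "ball y q"] q by auto
      have near: "\<bar>y \<bullet> x - d \<bullet> x\<bar> \<le> q * norm x" for x
      proof -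
        have "\<bar>y \<bullet> x - d \<bullet> x\<bar> \<le> norm (y - d) * norm x"
          using Cauchy_Schwarz_ineq2[of "y - d" x] by (simp add: inner_diff_left)
        also have "\<dots> \<le> q * norm x" using d by (intro mult_right_mono) (auto simp: dist_norm)
        finally show ?thesis .
      qed
      have "f \<in> cb d q" using fV near by (simp add: cb_def y)
      moreover have "cb d q \<subseteq> U"
      proof
        fix g assume g: "g \<in> cb d q"
        have "sqrt_range_dual_norm Q (\<lambda>v. g v - f v) \<le> 2 * q"
        proof (rule sqrt_range_dual_norm_le)
          fix x
          have "\<bar>g (op_sqrt Q x) - d \<bullet> x\<bar> \<le> q * norm x" using g by (simp add: cb_def)
          with near[of x] show "\<bar>g (op_sqrt Q x) - f (op_sqrt Q x)\<bar> \<le> 2 * q * norm x"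
            unfolding y by linarith
        qed (use q in simp)
        then show "g \<in> U" using g q by (intro ball) (auto simp: cb_def)
      qed
      ultimately show "f \<in> (\<Union>p\<in>?I. cb (fst p) (snd p))"
        using d q by (intro UN_I[of "(d, q)"]) auto
    qed auto
    have "countable ?I"
      by (rule countable_subset[of _ "D \<times> \<rat>"]) (auto simp: D(1) countable_rat)
    then have "(\<Union>p\<in>?I. cb (fst p) (snd p)) \<in> sigma_sets ?V ?E"
      using cb_sets unfolding E by (intro sets.countable_UN') auto
    then show "U \<in> sigma_sets ?V ?E"
      using U_eq by (rule back_subst[OF _ sym])
  qed
qed

lemma measurable_into_dual:
  assumes "\<And>x. x \<in> space M \<Longrightarrow> g x \<in> sqrt_range_dual Q"
    and "\<And>v. v \<in> sqrt_range Q \<Longrightarrow> (\<lambda>x. g x v) \<in> borel_measurable M"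
  shows "g \<in> measurable M (sqrt_range_dual_borel Q)"
proof (rule measurable_sigma_sets[OF sets_dual_borel_eval])
  fix Y assume "Y \<in> {(\<lambda>f. f v) -` B \<inter> sqrt_range_dual Q | v B. v \<in> sqrt_range Q \<and> B \<in> sets borel}"
  then obtain v B where vB: "v \<in> sqrt_range Q" "B \<in> sets borel" "Y = (\<lambda>f. f v) -` B \<inter> sqrt_range_dual Q" by blast
  have "g -` Y \<inter> space M = (\<lambda>x. g x v) -` B \<inter> space M" using vB(3) assms(1) by auto
  then show "g -` Y \<inter> space M \<in> sets M" using measurable_sets[OF assms(2)] vB by simp
qed (use assms(1) in auto)

end

section \<open>The law of the noise and its shifts\<close>

lemma positive_trace_classD: "positive_trace_class Q \<Longrightarrow> positive_selfadjoint Q"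
  by (simp add: positive_trace_class_def)

text \<open>The squared increment \<open>w(v n - z)^2\<close> has mean \<open>|v n - z|^2\<close>,
  which tends to \<open>0\<close>; convergence in \<open>L^1\<close> yields almost sure convergence
  along a subsequence.\<close>

lemma white_noise_tendsto_AE_subseq:
  fixes w :: "'w \<Rightarrow> 'y::real_inner \<Rightarrow> real"
  assumes wn: "white_noise P w" and lim: "v \<longlonglongrightarrow> z"
  obtains r :: "nat \<Rightarrow> nat" where "AE \<omega> in P. (\<lambda>n. w \<omega> (v (r n))) \<longlonglongrightarrow> w \<omega> z"
proof -
  have meas[measurable]: "(\<lambda>\<omega>. w \<omega> g) \<in> borel_measurable P" for g using white_noise_measurable[OF wn] .
  define u where "u n \<omega> = (w \<omega> (v n - z))\<^sup>2" for n \<omega>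
  have [measurable]: "u n \<in> borel_measurable P" for n unfolding u_def by measurable
  have int_u: "(\<integral>\<omega>. u n \<omega> \<partial>P) = (norm (v n - z))\<^sup>2" for n
    using wn by (simp add: u_def white_noise_def power2_eq_square flip: power2_norm_eq_inner)
  \<comment> \<open>A Bochner integral that is not \<open>0\<close> certifies integrability, because
    nonintegrable functions have integral \<open>0\<close> by convention. The case
    \<open>v n = z\<close>, where the integral does vanish, is therefore treated by hand.\<close>
  have integrable: "integrable P (u n)" for n
  proof (cases "v n - z = 0")
    case True
    have "AE \<omega> in P. u n \<omega> = 0"
      using white_noise_AE_linear[OF wn] by eventually_elim (simp add: u_def True linear_0)
    then have "integrable P (u n) \<longleftrightarrow> integrable P (\<lambda>_. 0::real)" by (intro integrable_cong_AE) auto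
    then show ?thesis by simp
  next
    case False
    then show ?thesis using int_u[of n] not_integrable_integral_eq[of P "u n"] by fastforce
  qed
  have "(\<lambda>n. (norm (v n - z))\<^sup>2) \<longlonglongrightarrow> (norm (z - z))\<^sup>2" by (intro tendsto_intros lim)
  moreover have "(\<integral>\<omega>. norm (u n \<omega>) \<partial>P) = (norm (v n - z))\<^sup>2" for n
    using int_u[of n] by (simp add: u_def)
  ultimately have "(\<lambda>n. \<integral>\<omega>. norm (u n \<omega>) \<partial>P) \<longlonglongrightarrow> 0" by simp
  then obtain r where r: "AE \<omega> in P. (\<lambda>n. u (r n) \<omega>) \<longlonglongrightarrow> 0"
    using tendsto_L1_AE_subseq[of P u, OF integrable] by blast
  have "AE \<omega> in P. (\<lambda>n. w \<omega> (v (r n))) \<longlonglongrightarrow> w \<omega> z"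
    using r white_noise_AE_linear[OF wn]
  proof eventually_elim
    case (elim \<omega>)
    have "(\<lambda>n. sqrt (u (r n) \<omega>)) \<longlonglongrightarrow> sqrt 0" by (intro tendsto_real_sqrt elim)
    then have "(\<lambda>n. w \<omega> (v (r n)) - w \<omega> z) \<longlonglongrightarrow> 0"
      using elim(2) by (simp add: u_def linear_diff tendsto_rabs_zero_iff)
    then show ?case by (rule LIM_zero_cancel)
  qed
  then show ?thesis by (rule that)
qed

context
  fixes P :: "'w measure" and w :: "'w \<Rightarrow> 'y::{real_inner,polish_space} \<Rightarrow> real" and \<sigma> :: real and Q :: "'y \<Rightarrow> 'y"
  assumes wn: "white_noise P w" and \<sigma>: "\<sigma> > 0" and Q: "positive_trace_class Q"
begin

interpretation prob_space P using wn by (simp add: white_noise_def)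

lemmas selfadjoint_Q = positive_trace_classD[OF Q]

definition noise_map :: "'w \<Rightarrow> 'y \<Rightarrow> real" where
  "noise_map \<omega> = (let f = restrict (\<lambda>v. \<sigma> * w \<omega> v) (sqrt_range Q)
     in if f \<in> sqrt_range_dual Q then f else restrict (\<lambda>v. 0) (sqrt_range Q))"

lemma AE_noise_mem_dual: "AE \<omega> in P. restrict (\<lambda>v. \<sigma> * w \<omega> v) (sqrt_range Q) \<in> sqrt_range_dual Q"
proof -
  have "AE \<omega> in P. restrict (w \<omega>) (sqrt_range Q) \<in> sqrt_range_dual Q"
    using wn Q by (simp add: white_noise_def)
  then show ?thesis
    by eventually_elim (auto simp: mem_sqrt_range_dual_iff[OF selfadjoint_Q] intro: bounded_linear_const_mult)
qed

lemma AE_noise_map: "AE \<omega> in P. noise_map \<omega> = restrict (\<lambda>v. \<sigma> * w \<omega> v) (sqrt_range Q)"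
  using AE_noise_mem_dual by eventually_elim (simp add: noise_map_def)

lemma noise_map_mem_dual: "noise_map \<omega> \<in> sqrt_range_dual Q"
  by (simp add: noise_map_def Let_def mem_sqrt_range_dual_iff[OF selfadjoint_Q] )

text \<open>The event on which the noise fails to be a dual element is only known to lie inside a
  null set of \<open>P\<close>, so it is measurable for the completion. Measurability into the dual
  then reduces to evaluations.\<close>

lemma noise_map_measurable [measurable]: "noise_map \<in> measurable (completion P) (sqrt_range_dual_borel Q)"
proof (rule measurable_into_dual[OF selfadjoint_Q noise_map_mem_dual])
  fix v assume v: "v \<in> sqrt_range Q"
  let ?F = "{\<omega> \<in> space P. restrict (\<lambda>v. \<sigma> * w \<omega> v) (sqrt_range Q) \<notin> sqrt_range_dual Q}"
  obtain N where N: "N \<in> null_sets P" "?F \<subseteq> N"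
    using AE_noise_mem_dual unfolding eventually_ae_filter by blast
  have F: "?F \<in> sets (completion P)" by (rule sets_completionI_sub[OF N])
  have "(\<lambda>\<omega>. if \<omega> \<in> ?F then 0 else \<sigma> * w \<omega> v) \<in> borel_measurable (completion P)"
    using F measurable_completion[OF white_noise_measurable[OF wn]] by (intro measurable_If_set) auto
  also have "?this \<longleftrightarrow> (\<lambda>\<omega>. noise_map \<omega> v) \<in> borel_measurable (completion P)"
    using v by (intro measurable_cong) (auto simp: noise_map_def Let_def)
  finally show "(\<lambda>\<omega>. noise_map \<omega> v) \<in> borel_measurable (completion P)" .
qed

lemma noise_law_eq: "noise_law P w \<sigma> Q = distr (completion P) (sqrt_range_dual_borel Q) noise_map"
  unfolding noise_law_def noise_map_def ..

lemma prob_space_noise_law: "prob_space (noise_law P w \<sigma> Q)"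
  unfolding noise_law_eq by (intro prob_space.prob_space_distr prob_space_completion noise_map_measurable)

lemma sets_noise_law [simp, measurable_cong]: "sets (noise_law P w \<sigma> Q) = sets (sqrt_range_dual_borel Q)"
  by (simp add: noise_law_eq)

lemma space_noise_law [simp]: "space (noise_law P w \<sigma> Q) = sqrt_range_dual Q"
  by (simp add: noise_law_eq space_dual_borel[OF selfadjoint_Q])

text \<open>The change of variables passes through the completion, for which
  \<open>noise_map\<close> is measurable; back on \<open>P\<close>, \<open>noise_map\<close> may be
  replaced by the restricted noise almost everywhere.\<close>

lemma nn_integral_noise_law:
  assumes G: "G \<in> borel_measurable (sqrt_range_dual_borel Q)"
    and eq: "AE \<omega> in P. G (restrict (\<lambda>v. \<sigma> * w \<omega> v) (sqrt_range Q)) = H \<omega>"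
  shows "(\<integral>\<^sup>+f. G f \<partial>noise_law P w \<sigma> Q) = (\<integral>\<^sup>+\<omega>. H \<omega> \<partial>P)"
proof -
  have "(\<integral>\<^sup>+f. G f \<partial>noise_law P w \<sigma> Q) = (\<integral>\<^sup>+\<omega>. G (noise_map \<omega>) \<partial>completion P)"
    unfolding noise_law_eq using noise_map_measurable G by (simp add: nn_integral_distr)
  also have "\<dots> = (\<integral>\<^sup>+\<omega>. G (noise_map \<omega>) \<partial>P)" by (rule nn_integral_completion)
  also have "\<dots> = (\<integral>\<^sup>+\<omega>. H \<omega> \<partial>P)"
  proof (rule nn_integral_cong_AE)
    show "AE \<omega> in P. G (noise_map \<omega>) = H \<omega>"
      using AE_noise_map eq by eventually_elim simp
  qed
  finally show ?thesis .
qed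

lemma integral_noise_law:
  fixes G :: "('y \<Rightarrow> real) \<Rightarrow> 'b::{banach,second_countable_topology}"
  assumes G: "G \<in> borel_measurable (sqrt_range_dual_borel Q)" and H: "H \<in> borel_measurable P"
    and eq: "AE \<omega> in P. G (restrict (\<lambda>v. \<sigma> * w \<omega> v) (sqrt_range Q)) = H \<omega>"
  shows "(\<integral>f. G f \<partial>noise_law P w \<sigma> Q) = (\<integral>\<omega>. H \<omega> \<partial>P)"
proof -
  have "(\<integral>f. G f \<partial>noise_law P w \<sigma> Q) = (\<integral>\<omega>. G (noise_map \<omega>) \<partial>completion P)"
    unfolding noise_law_eq by (rule integral_distr[OF noise_map_measurable G])
  also have "\<dots> = (\<integral>\<omega>. H \<omega> \<partial>completion P)"
  proof (rule integral_cong_AE)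
    have "AE \<omega> in P. G (noise_map \<omega>) = H \<omega>"
      using AE_noise_map eq by eventually_elim simp
    then show "AE \<omega> in completion P. G (noise_map \<omega>) = H \<omega>" by (rule AE_completion)
  qed (use measurable_compose[OF noise_map_measurable G] measurable_completion[OF H] in auto)
  also have "\<dots> = (\<integral>\<omega>. H \<omega> \<partial>P)" by (rule integral_completion[OF H])
  finally show ?thesis .
qed

section \<open>Shifted laws and their densities\<close>

lemma shift_mem_dual:
  assumes "f \<in> sqrt_range_dual Q"
  shows "restrict (\<lambda>v. f v + z \<bullet> v) (sqrt_range Q) \<in> sqrt_range_dual Q"
proof -
  have "bounded_linear (op_sqrt Q)" using op_sqrt(1)[OF selfadjoint_Q] by (simp add: positive_selfadjoint_def)
  then have "bounded_linear (\<lambda>x. z \<bullet> op_sqrt Q x)"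
    by (rule bounded_linear_compose[OF bounded_linear_inner_right])
  then show ?thesis
    using assms by (auto simp: mem_sqrt_range_dual_iff[OF selfadjoint_Q] intro: bounded_linear_add)
qed

lemma shift_measurable [measurable]:
  "(\<lambda>f. restrict (\<lambda>v. f v + z \<bullet> v) (sqrt_range Q)) \<in> measurable (noise_law P w \<sigma> Q) (sqrt_range_dual_borel Q)"
proof (rule measurable_into_dual[OF selfadjoint_Q])
  fix v assume v: "v \<in> sqrt_range Q"
  then have "(\<lambda>f. f v + z \<bullet> v) \<in> borel_measurable (sqrt_range_dual_borel Q)"
    using measurable_dual_eval[OF selfadjoint_Q v] by measurable
  then show "(\<lambda>f. restrict (\<lambda>v. f v + z \<bullet> v) (sqrt_range Q) v) \<in> borel_measurable (noise_law P w \<sigma> Q)"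
    using v by simp
qed (simp add: shift_mem_dual)

text \<open>The functional \<open>w(z)\<close> is not defined on the dual of the range of the square root; it is
  recovered almost surely as the limit of evaluations at points of this range tending to \<open>z\<close>.\<close>

lemma cameron_martin:
  obtains \<rho> where "\<rho> \<in> borel_measurable (sqrt_range_dual_borel Q)"
    "shifted_noise_law P w \<sigma> Q z = density (noise_law P w \<sigma> Q) (\<lambda>f. ennreal (exp (\<rho> f)))"
    "AE \<omega> in P. \<rho> (restrict (\<lambda>v. \<sigma> * w \<omega> v) (sqrt_range Q)) = - Psi \<sigma> z (\<lambda>g. \<sigma> * w \<omega> g)"
proof -
  have wm[measurable]: "(\<lambda>\<omega>. w \<omega> g) \<in> borel_measurable P" for g by (rule white_noise_measurable[OF wn])
  let ?V = "sqrt_range Q" and ?\<nu> = "noise_law P w \<sigma> Q" and ?\<mu> = "shifted_noise_law P w \<sigma> Q z"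
  interpret \<nu>: prob_space ?\<nu> by (rule prob_space_noise_law)
  have "z \<in> closure ?V" by (simp add: closure_sqrt_range[OF selfadjoint_Q])
  then obtain v where v: "\<And>n. v n \<in> ?V" "v \<longlonglongrightarrow> z" unfolding closure_sequential by blast
  obtain r where r: "AE \<omega> in P. (\<lambda>n. w \<omega> (v (r n))) \<longlonglongrightarrow> w \<omega> z"
    using white_noise_tendsto_AE_subseq[OF wn v(2)] by blast
  \<comment> \<open>At the noise the limit is \<open>\<sigma> * w(z)\<close>, so that dividing by
    \<open>\<sigma>\<^sup>2\<close> leaves \<open>w(z) / \<sigma>\<close>. Where the sequence
    diverges \<open>lim\<close> is an arbitrary value, which matters only on a null set.\<close>
  define \<rho> where "\<rho> f = lim (\<lambda>n. f (v (r n))) / \<sigma>\<^sup>2 - (norm z)\<^sup>2 / (2 * \<sigma>\<^sup>2)" for f :: "'y \<Rightarrow> real"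
  note ev[measurable] = measurable_dual_eval[OF selfadjoint_Q]
  have \<rho>[measurable]: "\<rho> \<in> borel_measurable (sqrt_range_dual_borel Q)"
    unfolding \<rho>_def using v(1) by measurable
  have AE_\<rho>: "AE \<omega> in P. \<rho> (restrict (\<lambda>v. \<sigma> * w \<omega> v) ?V) = w \<omega> z / \<sigma> - (norm z)\<^sup>2 / (2 * \<sigma>\<^sup>2)"
    using r
  proof eventually_elim
    case (elim \<omega>)
    have "(\<lambda>n. \<sigma> * w \<omega> (v (r n))) \<longlonglongrightarrow> \<sigma> * w \<omega> z" by (intro tendsto_intros elim)
    then have "lim (\<lambda>n. \<sigma> * w \<omega> (v (r n))) = \<sigma> * w \<omega> z" by (rule limI)
    then show ?case using v(1) \<sigma> by (simp add: \<rho>_def power2_eq_square)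
  qed
  have m_exp: "(\<lambda>f. ennreal (exp (\<rho> f))) \<in> borel_measurable ?\<nu>" by measurable
  define b where "b = (1 / \<sigma>) *\<^sub>R z"
  have norm_b: "(norm b)\<^sup>2 / 2 = (norm z)\<^sup>2 / (2 * \<sigma>\<^sup>2)"
    using \<sigma> by (simp add: b_def power_divide)
  have AE_b: "AE \<omega> in P. \<rho> (restrict (\<lambda>v. \<sigma> * w \<omega> v) ?V) = w \<omega> b - (norm b)\<^sup>2 / 2"
    using AE_\<rho> white_noise_AE_linear[OF wn]
    by eventually_elim (simp add: norm_b, simp add: b_def linear_scale)
  have AE_scale: "AE \<omega> in P. \<sigma> * w \<omega> u = w \<omega> (\<sigma> *\<^sub>R u)" for u
    using white_noise_AE_linear[OF wn] by eventually_elim (simp add: linear_scale)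
  have dens: "density ?\<nu> (\<lambda>f. ennreal (exp (\<rho> f))) = ?\<mu>"
  proof (rule measure_eq_charI[where I="?V" and X="\<lambda>u f. f u"])
    have "(\<integral>\<^sup>+f. ennreal (exp (\<rho> f)) \<partial>?\<nu>) = (\<integral>\<^sup>+\<omega>. ennreal (exp (w \<omega> b - (norm b)\<^sup>2 / 2)) \<partial>P)"
    proof (rule nn_integral_noise_law)
      show "AE \<omega> in P. ennreal (exp (\<rho> (restrict (\<lambda>v. \<sigma> * w \<omega> v) ?V))) = ennreal (exp (w \<omega> b - (norm b)\<^sup>2 / 2))"
        using AE_b by eventually_elim simp
    qed measurable
    also have "\<dots> < \<infinity>"
      using white_noise_tilt_integrable[OF wn, of b] by (simp add: integrable_iff_bounded)
    finally show "finite_measure (density ?\<nu> (\<lambda>f. ennreal (exp (\<rho> f))))"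
      using emeasure_density[OF m_exp sets.top] by (intro finite_measureI) (simp cong: nn_integral_cong_simp)
    show "finite_measure ?\<mu>"
      unfolding shifted_noise_law_def by (intro prob_space.finite_measure \<nu>.prob_space_distr shift_measurable)
    show "sets ?\<mu> = sets (density ?\<nu> (\<lambda>f. ennreal (exp (\<rho> f))))"
      by (simp add: shifted_noise_law_def)
    show "?V \<noteq> {}" using op_sqrt_in_range[of Q] by blast
    show "(\<lambda>f. f u) \<in> borel_measurable (density ?\<nu> (\<lambda>f. ennreal (exp (\<rho> f))))" if "u \<in> ?V" for u
      using ev[OF that] by simp
    show "\<exists>k\<in>?V. \<forall>f\<in>space (density ?\<nu> (\<lambda>f. ennreal (exp (\<rho> f)))). f k = s * f i + t * f j"
      if "i \<in> ?V" "j \<in> ?V" for i j s t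
    proof
      show "s *\<^sub>R i + t *\<^sub>R j \<in> ?V"
        using that subspace_sqrt_range[OF selfadjoint_Q] by (intro subspace_add subspace_scale)
      show "\<forall>f\<in>space (density ?\<nu> (\<lambda>f. ennreal (exp (\<rho> f)))). f (s *\<^sub>R i + t *\<^sub>R j) = s * f i + t * f j"
        using that subspace_scale[OF subspace_sqrt_range[OF selfadjoint_Q]] by (simp add: sqrt_range_dual_def)
    qed
    show "sets (density ?\<nu> (\<lambda>f. ennreal (exp (\<rho> f)))) = sigma_sets (space (density ?\<nu> (\<lambda>f. ennreal (exp (\<rho> f)))))
        {(\<lambda>f. f i) -` B \<inter> space (density ?\<nu> (\<lambda>f. ennreal (exp (\<rho> f)))) |i B. i \<in> ?V \<and> B \<in> sets borel}"
      using sets_dual_borel_eval[OF selfadjoint_Q] by simp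
    fix u assume u: "u \<in> ?V"
    note [measurable] = ev[OF u]
    have "(CLINT f|density ?\<nu> (\<lambda>f. ennreal (exp (\<rho> f))). iexp (f u)) = (CLINT f|?\<nu>. exp (\<rho> f) *\<^sub>R iexp (f u))"
      by (intro integral_density) auto
    also have "\<dots> = (CLINT \<omega>|P. exp (w \<omega> b - (norm b)\<^sup>2 / 2) *\<^sub>R iexp (w \<omega> (\<sigma> *\<^sub>R u)))"
    proof (rule integral_noise_law)
      show "AE \<omega> in P. exp (\<rho> (restrict (\<lambda>v. \<sigma> * w \<omega> v) ?V)) *\<^sub>R iexp (restrict (\<lambda>v. \<sigma> * w \<omega> v) ?V u) =
          exp (w \<omega> b - (norm b)\<^sup>2 / 2) *\<^sub>R iexp (w \<omega> (\<sigma> *\<^sub>R u))"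
        using AE_b AE_scale[of u] by eventually_elim (simp only: restrict_apply u if_True)
    qed auto
    \<comment> \<open>The factor \<open>1 / \<sigma>\<close> in \<open>b\<close> cancels the
      \<open>\<sigma>\<close> in \<open>\<sigma> *\<^sub>R u\<close>, so the mean is
      \<open>z \<bullet> u\<close>.\<close>
    also have "\<dots> = iexp (z \<bullet> u) * exp (- (norm (\<sigma> *\<^sub>R u))\<^sup>2 / 2)"
      using \<sigma> white_noise_tilted_char[OF wn, of b "\<sigma> *\<^sub>R u"] by (simp add: b_def)
    also have "\<dots> = iexp (z \<bullet> u) * (CLINT \<omega>|P. iexp (w \<omega> (\<sigma> *\<^sub>R u)))"
      by (simp only: white_noise_char[OF wn])
    also have "\<dots> = (CLINT \<omega>|P. iexp (w \<omega> (\<sigma> *\<^sub>R u) + z \<bullet> u))"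
      by (simp add: ring_distribs exp_add mult.commute)
    also have "\<dots> = (CLINT f|?\<nu>. iexp (f u + z \<bullet> u))"
    proof (rule integral_noise_law[symmetric])
      show "AE \<omega> in P. iexp (restrict (\<lambda>v. \<sigma> * w \<omega> v) ?V u + z \<bullet> u) = iexp (w \<omega> (\<sigma> *\<^sub>R u) + z \<bullet> u)"
        using AE_scale[of u] by eventually_elim (simp only: restrict_apply u if_True)
    qed auto
    also have "\<dots> = (CLINT f|?\<mu>. iexp (f u))"
      unfolding shifted_noise_law_def using u by (subst integral_distr) auto
    finally show "(CLINT f|density ?\<nu> (\<lambda>f. ennreal (exp (\<rho> f))). iexp (f u)) = (CLINT f|?\<mu>. iexp (f u))" .
  qed
  have "AE \<omega> in P. \<rho> (restrict (\<lambda>v. \<sigma> * w \<omega> v) ?V) = - Psi \<sigma> z (\<lambda>g. \<sigma> * w \<omega> g)"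
    using AE_\<rho> by eventually_elim (use \<sigma> in \<open>simp add: Psi_def power2_eq_square\<close>)
  with \<rho> dens[symmetric] show ?thesis by (rule that)
qed

text \<open>Densities are unique almost everywhere, which identifies \<open>RN_deriv\<close> with
  the explicit exponential under the law on the dual. The identity is then pulled back along
  \<open>noise_map\<close>, first to the completion and from there to \<open>P\<close>.\<close>

lemma noise_law_log_density:
  "absolutely_continuous (noise_law P w \<sigma> Q) (shifted_noise_law P w \<sigma> Q z)"
  "AE \<omega> in P. - ln (enn2real (RN_deriv (noise_law P w \<sigma> Q) (shifted_noise_law P w \<sigma> Q z)
      (restrict (\<lambda>v. \<sigma> * w \<omega> v) (sqrt_range Q)))) = Psi \<sigma> z (\<lambda>g. \<sigma> * w \<omega> g)"
proof -
  let ?\<nu> = "noise_law P w \<sigma> Q" and ?\<mu> = "shifted_noise_law P w \<sigma> Q z"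
  obtain \<rho> where \<rho>: "\<rho> \<in> borel_measurable (sqrt_range_dual_borel Q)"
    and dens: "?\<mu> = density ?\<nu> (\<lambda>f. ennreal (exp (\<rho> f)))"
    and AE_\<rho>: "AE \<omega> in P. \<rho> (restrict (\<lambda>v. \<sigma> * w \<omega> v) (sqrt_range Q)) = - Psi \<sigma> z (\<lambda>g. \<sigma> * w \<omega> g)"
    by (rule cameron_martin)
  have m: "(\<lambda>f. ennreal (exp (\<rho> f))) \<in> borel_measurable ?\<nu>" using \<rho> by measurable
  show "absolutely_continuous ?\<nu> ?\<mu>" unfolding dens by (rule absolutely_continuousI_density[OF m])
  interpret \<nu>: prob_space ?\<nu> by (rule prob_space_noise_law)
  have "sigma_finite_measure ?\<mu>"
    unfolding shifted_noise_law_def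
    by (intro finite_measure.axioms prob_space.finite_measure \<nu>.prob_space_distr shift_measurable)
  then have "AE f in ?\<nu>. ennreal (exp (\<rho> f)) = RN_deriv ?\<nu> ?\<mu> f"
    by (rule RN_deriv_unique_sigma_finite[OF m dens[symmetric]])
  then have "AE \<omega> in completion P. ennreal (exp (\<rho> (noise_map \<omega>))) = RN_deriv ?\<nu> ?\<mu> (noise_map \<omega>)"
    by (subst (asm) (1) noise_law_eq) (rule AE_distrD[OF noise_map_measurable])
  then have "AE \<omega> in P. ennreal (exp (\<rho> (noise_map \<omega>))) = RN_deriv ?\<nu> ?\<mu> (noise_map \<omega>)"
    by (simp only: AE_completion_iff)
  then show "AE \<omega> in P. - ln (enn2real (RN_deriv ?\<nu> ?\<mu> (restrict (\<lambda>v. \<sigma> * w \<omega> v) (sqrt_range Q)))) = Psi \<sigma> z (\<lambda>g. \<sigma> * w \<omega> g)"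
    using AE_noise_map AE_\<rho>
  proof eventually_elim
    case (elim \<omega>)
    show ?case using elim(1)[symmetric] unfolding elim(2) elim(3) by simp
  qed
qed

end

section \<open>Boundedness of the noise on the range of a Hilbert--Schmidt operator\<close>

text \<open>The trace is computed in the basis belonging to \<open>Q\<close>: there
  \<open>A (A' e) \<bullet> e\<close> is \<open>|A' e|^2\<close>, which is summable because the
  adjoint is Hilbert--Schmidt in every basis. Strict positivity comes from \<open>Q\<close>.\<close>

lemma positive_trace_class_add_adjoint:
  fixes A :: "'x::{real_inner,polish_space} \<Rightarrow> 'y::{real_inner,polish_space}"
  assumes "hilbert_schmidt A" "positive_trace_class Q" "bounded_linear A'"
    and adj: "\<And>x y. A x \<bullet> y = x \<bullet> A' y"
  shows "positive_trace_class (\<lambda>y. A (A' y) + Q y)"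
proof -
  have A: "bounded_linear A" and Q: "bounded_linear Q" "\<And>x y. Q x \<bullet> y = x \<bullet> Q y" "\<And>x. x \<noteq> 0 \<Longrightarrow> 0 < Q x \<bullet> x"
    using assms by (auto simp: hilbert_schmidt_def positive_trace_class_def positive_selfadjoint_def)
  have adj': "x \<bullet> A y = A' x \<bullet> y" for x y by (metis adj inner_commute)
  obtain B where B: "orthonormal_basis B" "(\<lambda>e. (norm (A e))\<^sup>2) summable_on B"
    using assms(1) by (auto simp: hilbert_schmidt_def)
  obtain B' where B': "orthonormal_basis B'" "(\<lambda>e. Q e \<bullet> e) summable_on B'"
    using assms(2) by (auto simp: positive_trace_class_def)
  have "(\<lambda>e. (norm (A' e))\<^sup>2) summable_on B'" by (rule summable_on_adjoint[OF B B'(1) adj])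
  then have "(\<lambda>e. (norm (A' e))\<^sup>2 + Q e \<bullet> e) summable_on B'" using B'(2) by (rule summable_on_add)
  moreover have "(A (A' e) + Q e) \<bullet> e = (norm (A' e))\<^sup>2 + Q e \<bullet> e" for e
    by (simp add: inner_add_left adj power2_norm_eq_inner)
  moreover have "bounded_linear (\<lambda>y. A (A' y) + Q y)"
    by (intro bounded_linear_add bounded_linear_compose[OF A assms(3)] Q(1))
  moreover have "(A (A' x) + Q x) \<bullet> y = x \<bullet> (A (A' y) + Q y)" for x y
    by (simp add: inner_add_left inner_add_right adj adj' Q(2))
  ultimately show ?thesis
    using B'(1) Q(3) by (auto simp: positive_trace_class_def positive_selfadjoint_def intro!: add_nonneg_pos)
qed

text \<open>Douglas' lemma; the last hypothesis is \<open>A A' \<le> S S\<close>.\<close>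

lemma douglas_factor:
  fixes A :: "'x::real_inner \<Rightarrow> 'y::{real_inner,complete_space}"
  assumes S: "positive_selfadjoint S" and adj: "\<And>x y. A x \<bullet> y = x \<bullet> A' y" and A': "bounded_linear A'"
    and le: "\<And>y. norm (A' y) \<le> norm (S y)"
  obtains x where "S x = A u" "norm x \<le> norm u"
proof -
  interpret S: bounded_linear S using S by (simp add: positive_selfadjoint_def)
  interpret A': bounded_linear A' by fact
  have inv: "inv S (S y) = y" for y by (simp add: inj_positive_selfadjoint[OF S])
  \<comment> \<open>On the range of \<open>S\<close> the assignment
    \<open>S y \<mapsto> u \<bullet> A' y\<close> is well defined by injectivity and bounded by
    \<open>norm u\<close> thanks to \<open>le\<close>; self-adjointness of \<open>S\<close> makes
    its representer the preimage of \<open>A u\<close>.\<close>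
  obtain x where x: "\<And>m. m \<in> range S \<Longrightarrow> x \<bullet> m = u \<bullet> A' (inv S m)" "norm x \<le> norm u"
  proof (rule riesz_subspace[of "range S" "\<lambda>m. u \<bullet> A' (inv S m)" "norm u"])
    show "subspace (range S)" using linear_subspace_image S.linear_axioms subspace_UNIV by blast
    show "\<bar>u \<bullet> A' (inv S m)\<bar> \<le> norm u * norm m" if m: "m \<in> range S" for m
    proof -
      obtain y where y: "m = S y" using m by blast
      have "\<bar>u \<bullet> A' y\<bar> \<le> norm u * norm (A' y)" by (rule Cauchy_Schwarz_ineq2)
      also have "\<dots> \<le> norm u * norm m" using le[of y] y by (simp add: mult_left_mono)
      finally show ?thesis by (simp add: y inv)
    qed
    show "u \<bullet> A' (inv S (a + b)) = u \<bullet> A' (inv S a) + u \<bullet> A' (inv S b)" if "a \<in> range S" "b \<in> range S" for a b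
      using that by (auto simp: S.add[symmetric] inv A'.add inner_add_right simp del: S.add)
    show "u \<bullet> A' (inv S (c *\<^sub>R a)) = c * (u \<bullet> A' (inv S a))" if "a \<in> range S" for a c
      using that by (auto simp: S.scaleR[symmetric] inv A'.scaleR simp del: S.scaleR)
  qed auto
  have "S x \<bullet> y = A u \<bullet> y" for y
    using x(1)[of "S y"] S by (simp add: inv adj positive_selfadjoint_def)
  then have "S x = A u" using vector_eq_rdot by blast
  then show ?thesis using x(2) that by blast
qed

lemma white_noise_AE_bounded_hilbert_schmidt:
  fixes A :: "'x::{real_inner,polish_space} \<Rightarrow> 'y::{real_inner,polish_space}"
    and w :: "'w \<Rightarrow> 'y \<Rightarrow> real" and Q :: "'y \<Rightarrow> 'y"
  assumes wn: "white_noise P w" and Q: "positive_trace_class Q" and A: "hilbert_schmidt A"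
  shows "AE \<omega> in P. \<exists>C\<ge>0. \<forall>u. \<bar>w \<omega> (A u)\<bar> \<le> C * norm u"
proof -
  have "bounded_linear A" using A by (simp add: hilbert_schmidt_def)
  from bounded_linear_adjoint[OF this]
  obtain A' where A': "bounded_linear A'" and adj: "\<And>x y. A x \<bullet> y = x \<bullet> A' y" by blast
  define K where "K y = A (A' y) + Q y" for y
  have K: "positive_trace_class K"
    unfolding K_def by (rule positive_trace_class_add_adjoint[OF A Q A' adj])
  then have sa: "positive_selfadjoint K" by (simp add: positive_trace_class_def)
  let ?S = "op_sqrt K"
  have S: "positive_selfadjoint ?S" by (rule op_sqrt(1)[OF sa])
  \<comment> \<open>In terms of quadratic forms, \<open>|A' y|^2 = A (A' y) \<bullet> y \<le> K y
    \<bullet> y = |?S y|^2\<close>.\<close>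
  have "norm (A' y) \<le> norm (?S y)" for y
  proof -
    have "0 \<le> Q y \<bullet> y"
      using Q by (cases "y = 0") (auto simp: positive_trace_class_def positive_selfadjoint_def less_imp_le)
    then have "(norm (A' y))\<^sup>2 \<le> K y \<bullet> y" by (simp add: K_def inner_add_left adj power2_norm_eq_inner)
    also have "K y = ?S (?S y)" by (simp add: op_sqrt(2)[OF sa])
    also have "?S (?S y) \<bullet> y = (norm (?S y))\<^sup>2"
      using S by (simp add: positive_selfadjoint_def power2_norm_eq_inner)
    finally show ?thesis by (rule power2_le_imp_le) simp
  qed
  then have factor: "\<exists>x. ?S x = A u \<and> norm x \<le> norm u" for u
    using douglas_factor[OF S adj A'] by metis
  have "AE \<omega> in P. restrict (w \<omega>) (sqrt_range K) \<in> sqrt_range_dual K"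
    using wn K by (simp add: white_noise_def)
  then show ?thesis
  proof eventually_elim
    case (elim \<omega>)
    then have "bounded_linear (\<lambda>x. w \<omega> (?S x))"
      by (simp add: mem_sqrt_range_dual_iff[OF sa])
    then obtain C where C: "C \<ge> 0" "\<And>x. norm (w \<omega> (?S x)) \<le> norm x * C"
      using bounded_linear.nonneg_bounded by blast
    have "\<bar>w \<omega> (A u)\<bar> \<le> C * norm u" for u
    proof -
      obtain x where x: "?S x = A u" "norm x \<le> norm u" using factor by blast
      have "\<bar>w \<omega> (A u)\<bar> \<le> norm x * C" using C(2)[of x] x(1) by simp
      also have "\<dots> \<le> norm u * C" using x(2) C(1) by (rule mult_right_mono)
      finally show ?thesis by (simp add: mult.commute)
    qed
    then show ?case using C(1) by blast
  qed
qed

section \<open>Bounds on the negative log-likelihood\<close>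

lemma Phi_bounds:
  fixes y :: "'y::real_inner \<Rightarrow> real"
  assumes A: "bounded_linear A" and \<sigma>: "\<sigma> > 0" and lin: "linear (\<lambda>u. y (A u))"
    and bound: "\<And>u. \<bar>y (A u)\<bar> \<le> C * norm u" and C: "C \<ge> 0"
  shows "\<forall>r>0. \<exists>L>0. \<forall>u1\<in>ball 0 r. \<forall>u2\<in>ball 0 r. \<bar>Phi A \<sigma> u1 y - Phi A \<sigma> u2 y\<bar> \<le> L * norm (u1 - u2)"
    and "\<exists>L\<ge>0. \<forall>v. Phi A \<sigma> v y \<ge> Phi A \<sigma> 0 y - L * norm v"
proof -
  interpret A: bounded_linear A by fact
  obtain K where K: "K > 0" "\<And>x. norm (A x) \<le> norm x * K" using A.pos_bounded by blast
  show "\<forall>r>0. \<exists>L>0. \<forall>u1\<in>ball 0 r. \<forall>u2\<in>ball 0 r. \<bar>Phi A \<sigma> u1 y - Phi A \<sigma> u2 y\<bar> \<le> L * norm (u1 - u2)"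
  proof (intro allI impI)
    fix r :: real assume r: "r > 0"
    \<comment> \<open>A difference of squared norms is at most \<open>norm (u1 - u2) * K\<close>
      times \<open>2 * r * K\<close>; halved, this contributes \<open>r * K * K\<close>. The linear
      part contributes \<open>C\<close>, and \<open>\<sigma>\<^sup>2\<close> is the common
      denominator.\<close>
    define L where "L = (r * K * K + C) / \<sigma>\<^sup>2"
    have "L > 0" using r K C \<sigma> by (simp add: L_def add_pos_nonneg)
    moreover have "\<bar>Phi A \<sigma> u1 y - Phi A \<sigma> u2 y\<bar> \<le> L * norm (u1 - u2)"
      if u: "u1 \<in> ball 0 r" "u2 \<in> ball 0 r" for u1 u2
    proof -
      let ?d = "norm (u1 - u2)"
      have "\<bar>(norm (A u1))\<^sup>2 - (norm (A u2))\<^sup>2\<bar> = \<bar>norm (A u1) - norm (A u2)\<bar> * (norm (A u1) + norm (A u2))"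
        by (simp add: power2_eq_square square_diff_square_factored abs_mult mult.commute)
      also have "\<dots> \<le> (?d * K) * (r * K + r * K)"
      proof (intro mult_mono add_mono)
        show "\<bar>norm (A u1) - norm (A u2)\<bar> \<le> ?d * K"
          using norm_triangle_ineq3[of "A u1" "A u2"] K(2)[of "u1 - u2"] by (simp add: A.diff)
        show "norm (A u1) \<le> r * K" "norm (A u2) \<le> r * K"
          using u K(1) by (auto intro!: order_trans[OF K(2)] mult_right_mono)
      qed (use K r in auto)
      finally have 1: "\<bar>(norm (A u1))\<^sup>2 - (norm (A u2))\<^sup>2\<bar> \<le> 2 * (r * K * K * ?d)" by (simp add: algebra_simps)
      have 2: "\<bar>y (A u1) - y (A u2)\<bar> \<le> C * ?d"
        using bound[of "u1 - u2"] by (simp add: linear_diff[OF lin])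
      have "\<sigma>\<^sup>2 * (Phi A \<sigma> u1 y - Phi A \<sigma> u2 y) =
          ((norm (A u1))\<^sup>2 - (norm (A u2))\<^sup>2) / 2 - (y (A u1) - y (A u2))"
        using \<sigma> by (simp add: Phi_def Psi_def field_simps)
      then have "\<sigma>\<^sup>2 * \<bar>Phi A \<sigma> u1 y - Phi A \<sigma> u2 y\<bar> = \<bar>((norm (A u1))\<^sup>2 - (norm (A u2))\<^sup>2) / 2 - (y (A u1) - y (A u2))\<bar>"
        by (metis abs_mult abs_of_nonneg zero_le_power2)
      also have "\<dots> \<le> r * K * K * ?d + C * ?d"
      proof -
        have "\<bar>a / 2 - c\<bar> \<le> p + q" if "\<bar>a\<bar> \<le> 2 * p" "\<bar>c\<bar> \<le> q" for a c p q :: real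
          using that by linarith
        from this[OF 1 2] show ?thesis .
      qed
      also have "\<dots> = \<sigma>\<^sup>2 * (L * ?d)" using \<sigma> by (simp add: L_def field_simps)
      finally show ?thesis using \<sigma> by simp
    qed
    ultimately show "\<exists>L>0. \<forall>u1\<in>ball 0 r. \<forall>u2\<in>ball 0 r. \<bar>Phi A \<sigma> u1 y - Phi A \<sigma> u2 y\<bar> \<le> L * norm (u1 - u2)"
      by blast
  qed
  have "y (A 0) = 0" using linear_0[OF lin] .
  \<comment> \<open>The quadratic term is nonnegative and is dropped, so only the bound on the
    linear term enters.\<close>
  then have "Phi A \<sigma> 0 y - C / \<sigma>\<^sup>2 * norm v \<le> Phi A \<sigma> v y" for v
  proof -
    have "y (A v) / \<sigma>\<^sup>2 \<le> C / \<sigma>\<^sup>2 * norm v"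
      using bound[of v] \<sigma> by (simp add: divide_right_mono)
    moreover have "0 \<le> (norm (A v))\<^sup>2 / (2 * \<sigma>\<^sup>2)" by simp
    moreover have "Phi A \<sigma> v y = (norm (A v))\<^sup>2 / (2 * \<sigma>\<^sup>2) - y (A v) / \<sigma>\<^sup>2" "Phi A \<sigma> 0 y = 0"
      using \<open>y (A 0) = 0\<close> by (simp_all add: Phi_def Psi_def A.zero)
    ultimately show ?thesis by linarith
  qed
  then show "\<exists>L\<ge>0. \<forall>v. Phi A \<sigma> v y \<ge> Phi A \<sigma> 0 y - L * norm v"
    using C by (intro exI[of _ "C / \<sigma>\<^sup>2"]) auto
qed

theorem corollary3p7:
  fixes A :: "'x::{real_inner,polish_space} \<Rightarrow> 'y::{real_inner,polish_space}"
    and Q :: "'y \<Rightarrow> 'y"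
    and P :: "'w measure"
    and w :: "'w \<Rightarrow> 'y \<Rightarrow> real"
    and \<sigma> :: real
  assumes "\<sigma> > 0"
    and "white_noise P w"
    and "positive_trace_class Q"
    and "hilbert_schmidt A"
    and "inj A"
  shows "(\<forall>z. absolutely_continuous (noise_law P w \<sigma> Q) (shifted_noise_law P w \<sigma> Q z) \<and>
            (AE \<omega> in P.
               - ln (enn2real (RN_deriv (noise_law P w \<sigma> Q) (shifted_noise_law P w \<sigma> Q z)
                       (restrict (\<lambda>v. \<sigma> * w \<omega> v) (sqrt_range Q))))
               = Psi \<sigma> z (\<lambda>g. \<sigma> * w \<omega> g))) \<and>
         (\<forall>u. AE \<omega> in P. \<forall>y. y = (\<lambda>g. A u \<bullet> g + \<sigma> * w \<omega> g) \<longrightarrow>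
            (\<forall>r>0. \<exists>L>0. \<forall>u1\<in>ball 0 r. \<forall>u2\<in>ball 0 r.
               \<bar>Phi A \<sigma> u1 y - Phi A \<sigma> u2 y\<bar> \<le> L * norm (u1 - u2)) \<and>
            (\<exists>L\<ge>0. \<forall>v. Phi A \<sigma> v y \<ge> Phi A \<sigma> 0 y - L * norm v))"
proof (intro conjI allI)
  show "absolutely_continuous (noise_law P w \<sigma> Q) (shifted_noise_law P w \<sigma> Q z)"
    "AE \<omega> in P. - ln (enn2real (RN_deriv (noise_law P w \<sigma> Q) (shifted_noise_law P w \<sigma> Q z)
      (restrict (\<lambda>v. \<sigma> * w \<omega> v) (sqrt_range Q)))) = Psi \<sigma> z (\<lambda>g. \<sigma> * w \<omega> g)" for z
    using noise_law_log_density[OF assms(2,1,3)] by blast+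
  fix u
  have A: "bounded_linear A" using assms(4) by (simp add: hilbert_schmidt_def)
  interpret A: bounded_linear A by fact
  obtain K where K: "K \<ge> 0" "\<And>x. norm (A x) \<le> norm x * K" using A.nonneg_bounded by blast
  show "AE \<omega> in P. \<forall>y. y = (\<lambda>g. A u \<bullet> g + \<sigma> * w \<omega> g) \<longrightarrow>
            (\<forall>r>0. \<exists>L>0. \<forall>u1\<in>ball 0 r. \<forall>u2\<in>ball 0 r.
               \<bar>Phi A \<sigma> u1 y - Phi A \<sigma> u2 y\<bar> \<le> L * norm (u1 - u2)) \<and>
            (\<exists>L\<ge>0. \<forall>v. Phi A \<sigma> v y \<ge> Phi A \<sigma> 0 y - L * norm v)"
    using white_noise_AE_bounded_hilbert_schmidt[OF assms(2,3,4)] white_noise_AE_linear[OF assms(2)]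
  proof eventually_elim
    \<comment> \<open>The exceptional set is the same for every \<open>u\<close>: the true parameter
      enters the data only through the functional \<open>A u \<bullet> g\<close>, which is bounded
      without any exception.\<close>
    case (elim \<omega>)
    then obtain C where C: "C \<ge> 0" "\<And>u. \<bar>w \<omega> (A u)\<bar> \<le> C * norm u" by blast
    let ?y = "\<lambda>g. A u \<bullet> g + \<sigma> * w \<omega> g"
    have "linear (\<lambda>v. ?y (A v))"
      by (rule linearI) (simp_all add: A.add A.scaleR linear_add[OF elim(2)] linear_scale[OF elim(2)] inner_add_right algebra_simps)
    \<comment> \<open>The first summand bounds the signal by Cauchy--Schwarz, the second the noise
      along the range of \<open>A\<close>.\<close>
    moreover have "\<bar>?y (A v)\<bar> \<le> (norm (A u) * K + \<sigma> * C) * norm v" for v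
    proof -
      have "\<bar>A u \<bullet> A v\<bar> \<le> norm (A u) * norm (A v)" by (rule Cauchy_Schwarz_ineq2)
      also have "\<dots> \<le> norm (A u) * (norm v * K)" by (intro mult_left_mono K) simp
      finally have 1: "\<bar>A u \<bullet> A v\<bar> \<le> norm (A u) * K * norm v" by (simp add: mult_ac)
      have "\<bar>\<sigma> * w \<omega> (A v)\<bar> \<le> \<sigma> * (C * norm v)"
        using assms(1) C(2)[of v] by (simp add: abs_mult)
      with 1 have "\<bar>?y (A v)\<bar> \<le> norm (A u) * K * norm v + \<sigma> * (C * norm v)" by linarith
      then show ?thesis by (simp add: algebra_simps)
    qed
    moreover have "0 \<le> norm (A u) * K + \<sigma> * C" using K C assms(1) by simp
    ultimately show ?case using Phi_bounds[OF A assms(1), of ?y] by blast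
  qed
qed

end
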